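(* Let $f\colon A\to B$ be a surjective quandle homomorphism. Define \[ R=\{(z\lhd x,\ z\lhd x') \mid z,x,x'\in A,\ f(x)=f(x')\}\subseteq A\times A, \] let $R_c$ be the congruence on $A$ generated by $R$, and let $q_{R_c}\colon A\to A/R_c$ be the quotient homomorphism. Then $R_c\subseteq \mathrm{Eq}(f)$, and the induced homomorphism $c\colon A/R_c\to B$ with $c\circ q_{R_c}=f$ is the reflection of $f$ in the category $\mathrm{CExt}(B)$ of central extensions of $B$; that is, $c$ is a central extension, and for every factorization $f=c'\circ q$ with $q\colon A\to A'$ a quandle homomorphism and $c'\colon A'\to B$ a central extension there is a unique quandle homomorphism $\phi\colon A/R_c\to A'$ such that $c'\circ\phi=c$ and $\phi\circ q_{R_c}=q$. Consequently, if $p\colon\tilde B\to B$ is a weakly universal central extension of $B$ and $p_1\colon\tilde B\times_B A\to\tilde B$, $p_2\colon\tilde B\times_BA\to A$ are the projections of the pullback of $f$ along $p$, then \[ p_2\bigl(\mathrm{Eq}(p_1)\cap\sim_{\mathrm{Inn}(\tilde B\times_BA)}\bigr)=R_c . \]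
   Context: A quandle is a (possibly empty) set $A$ with two binary operations $\lhd,\lhd^{-1}$ such that for all $a,b,c\in A$: $a\lhd a=a$; $(a\lhd b)\lhd^{-1}b=a=(a\lhd^{-1}b)\lhd b$; $(a\lhd b)\lhd c=(a\lhd c)\lhd(b\lhd c)$. Homomorphisms preserve both operations. A quandle is trivial if $a\lhd a'=a=a\lhd^{-1}a'$ for all $a,a'$. A congruence on $A$ is an equivalence relation on $A$ that is a subquandle of $A\times A$. For a homomorphism $f$, $\mathrm{Eq}(f)=\{(a,a') : f(a)=f(a')\}$. For a quandle $A$, $\mathrm{Inn}(A)$ is the subgroup of $\mathrm{Aut}(A)$ generated by all right translations $a\mapsto a\lhd b$ ($b\in A$); $a\sim_{\mathrm{Inn}(A)}a'$ means that $a,a'$ lie in the same $\mathrm{Inn}(A)$-orbit; $\pi_0(A)$ is the set of these orbits, regarded as a trivial quandle, and $\eta_A\colon A\to\pi_0(A)$ sends an element to its orbit. For a homomorphism $g\colon X\to Y$ and a relation $S\subseteq X\times X$, $g(S)=\{(g(x),g(x')) : (x,x')\in S\}$. An extension is a surjective quandle homomorphism $f\colon A\to B$. It is trivial if the naturality square $\pi_0(f)\circ\eta_A=\eta_B\circ f$ is a pullback. It is central if there is a surjective homomorphism $p\colon E\to B$ such that the projection $E\times_B A\to E$ of the pullback of $f$ along $p$ is a trivial extension; one then says that $f$ is split by $p$. (It is a known result that $f$ is central if and only if it is a quandle covering: $f$ is surjective and $f(a)=f(a')$ implies $c\lhd a=c\lhd a'$ for all $c\in A$.) A weakly universal central extension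 of $B$ is a central extension $p\colon\tilde B\to B$ such that every central extension of $B$ is split by $p$ (one is known to exist for every $B$). $\mathrm{CExt}(B)$ is the category of central extensions of $B$, with commutative triangles over $B$ as morphisms. *)

theory Defs
  imports "HOL-Algebra.Bij" "HOL-Algebra.Generated_Groups"
begin

text \<open>Carrier-based quandles; the empty carrier is allowed.\<close>

record 'a quandle = "'a partial_object" +
  qop  :: "'a \<Rightarrow> 'a \<Rightarrow> 'a" (infixl \<open>\<triangleleft>\<index>\<close> 70)
  qinv :: "'a \<Rightarrow> 'a \<Rightarrow> 'a" (infixl \<open>\<triangleleft>\<inverse>\<index>\<close> 70)

locale quandle =
  fixes Q :: "'a quandle" (structure)
  assumes op_closed [simp, intro]: "\<lbrakk>a \<in> carrier Q; b \<in> carrier Q\<rbrakk> \<Longrightarrow> a \<triangleleft> b \<in> carrier Q"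
    and inv_closed [simp, intro]: "\<lbrakk>a \<in> carrier Q; b \<in> carrier Q\<rbrakk> \<Longrightarrow> a \<triangleleft>\<inverse> b \<in> carrier Q"
    and idem: "a \<in> carrier Q \<Longrightarrow> a \<triangleleft> a = a"
    and op_inv [simp]: "\<lbrakk>a \<in> carrier Q; b \<in> carrier Q\<rbrakk> \<Longrightarrow> (a \<triangleleft> b) \<triangleleft>\<inverse> b = a"
    and inv_op [simp]: "\<lbrakk>a \<in> carrier Q; b \<in> carrier Q\<rbrakk> \<Longrightarrow> (a \<triangleleft>\<inverse> b) \<triangleleft> b = a"
    and distrib: "\<lbrakk>a \<in> carrier Q; b \<in> carrier Q; c \<in> carrier Q\<rbrakk>
        \<Longrightarrow> (a \<triangleleft> b) \<triangleleft> c = (a \<triangleleft> c) \<triangleleft> (b \<triangleleft> c)"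

definition quandle_hom :: "('a, 'm) quandle_scheme \<Rightarrow> ('b, 'n) quandle_scheme \<Rightarrow> ('a \<Rightarrow> 'b) set" where
  "quandle_hom X Y = {h \<in> carrier X \<rightarrow> carrier Y. \<forall>x\<in>carrier X. \<forall>y\<in>carrier X.
      h (x \<triangleleft>\<^bsub>X\<^esub> y) = h x \<triangleleft>\<^bsub>Y\<^esub> h y \<and> h (x \<triangleleft>\<inverse>\<^bsub>X\<^esub> y) = h x \<triangleleft>\<inverse>\<^bsub>Y\<^esub> h y}"

definition quandle_iso :: "('a, 'm) quandle_scheme \<Rightarrow> ('b, 'n) quandle_scheme \<Rightarrow> ('a \<Rightarrow> 'b) set" where
  "quandle_iso X Y = {h \<in> quandle_hom X Y. bij_betw h (carrier X) (carrier Y)}"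

definition trivial_quandle :: "'a set \<Rightarrow> 'a quandle" where
  "trivial_quandle S = \<lparr>carrier = S, qop = (\<lambda>x y. x), qinv = (\<lambda>x y. x)\<rparr>"

definition prod_quandle :: "'a quandle \<Rightarrow> 'b quandle \<Rightarrow> ('a \<times> 'b) quandle" where
  "prod_quandle X Y = \<lparr>carrier = carrier X \<times> carrier Y,
     qop = (\<lambda>(x, y) (x', y'). (x \<triangleleft>\<^bsub>X\<^esub> x', y \<triangleleft>\<^bsub>Y\<^esub> y')),
     qinv = (\<lambda>(x, y) (x', y'). (x \<triangleleft>\<inverse>\<^bsub>X\<^esub> x', y \<triangleleft>\<inverse>\<^bsub>Y\<^esub> y'))\<rparr>"

definition subquandle :: "'a set \<Rightarrow> 'a quandle \<Rightarrow> bool" where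
  "subquandle H Q \<longleftrightarrow> H \<subseteq> carrier Q \<and>
     (\<forall>x\<in>H. \<forall>y\<in>H. x \<triangleleft>\<^bsub>Q\<^esub> y \<in> H \<and> x \<triangleleft>\<inverse>\<^bsub>Q\<^esub> y \<in> H)"

definition congruence :: "'a quandle \<Rightarrow> 'a rel \<Rightarrow> bool" where
  "congruence A S \<longleftrightarrow> equiv (carrier A) S \<and> subquandle S (prod_quandle A A)"

definition congruence_generated :: "'a quandle \<Rightarrow> 'a rel \<Rightarrow> 'a rel" where
  "congruence_generated A R = \<Inter>{S. congruence A S \<and> R \<subseteq> S}"

definition quotient_quandle :: "'a quandle \<Rightarrow> 'a rel \<Rightarrow> 'a set quandle" where
  "quotient_quandle A S = \<lparr>carrier = carrier A // S,
     qop = (\<lambda>X Y. \<Union>x\<in>X. \<Union>y\<in>Y. S `` {x \<triangleleft>\<^bsub>A\<^esub> y}),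
     qinv = (\<lambda>X Y. \<Union>x\<in>X. \<Union>y\<in>Y. S `` {x \<triangleleft>\<inverse>\<^bsub>A\<^esub> y})\<rparr>"

definition quotient_map :: "'a rel \<Rightarrow> 'a \<Rightarrow> 'a set" where
  "quotient_map S a = S `` {a}"

definition Eq :: "'a quandle \<Rightarrow> ('a \<Rightarrow> 'b) \<Rightarrow> 'a rel" where
  "Eq A f = {(a, a') \<in> carrier A \<times> carrier A. f a = f a'}"

subsection \<open>Inner automorphisms and connected components\<close>

definition Aut :: "'a quandle \<Rightarrow> ('a \<Rightarrow> 'a) monoid" where
  "Aut Q = BijGroup (carrier Q) \<lparr>carrier := Bij (carrier Q) \<inter> quandle_hom Q Q\<rparr>"

definition right_translation :: "'a quandle \<Rightarrow> 'a \<Rightarrow> 'a \<Rightarrow> 'a" where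
  "right_translation Q b = (\<lambda>a\<in>carrier Q. a \<triangleleft>\<^bsub>Q\<^esub> b)"

definition Inn :: "'a quandle \<Rightarrow> ('a \<Rightarrow> 'a) set" where
  "Inn Q = generate (Aut Q) (right_translation Q ` carrier Q)"

definition inn_rel :: "'a quandle \<Rightarrow> 'a rel" where
  "inn_rel Q = {(a, a') \<in> carrier Q \<times> carrier Q. \<exists>g\<in>Inn Q. g a = a'}"

definition pi0 :: "'a quandle \<Rightarrow> 'a set quandle" where
  "pi0 Q = trivial_quandle (carrier Q // inn_rel Q)"

definition pi0_unit :: "'a quandle \<Rightarrow> 'a \<Rightarrow> 'a set" where
  "pi0_unit Q a = inn_rel Q `` {a}"

text \<open>The orbit of \<open>a\<close> goes to the orbit of \<open>f a\<close>, for \<open>f\<close> a homomorphism into \<open>Y\<close>.\<close>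

definition pi0_map :: "'b quandle \<Rightarrow> ('a \<Rightarrow> 'b) \<Rightarrow> 'a set \<Rightarrow> 'b set" where
  "pi0_map Y f X = the_elem ((\<lambda>a. pi0_unit Y (f a)) ` X)"

subsection \<open>Pullbacks and extensions\<close>

definition pullback :: "'x quandle \<Rightarrow> ('x \<Rightarrow> 'z) \<Rightarrow> 'y quandle \<Rightarrow> ('y \<Rightarrow> 'z) \<Rightarrow> ('x \<times> 'y) quandle" where
  "pullback X p Y f = (prod_quandle X Y)
     \<lparr>carrier := {(x, y) \<in> carrier X \<times> carrier Y. p x = f y}\<rparr>"

text \<open>The square \<open>p \<circ> u = f \<circ> v\<close> with \<open>u : P \<rightarrow> X\<close> and \<open>v : P \<rightarrow> Y\<close> is a pullback: the
  comparison map from \<open>P\<close> to the standard pullback is an isomorphism (commutativity included).\<close>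

definition is_pullback :: "'p quandle \<Rightarrow> ('p \<Rightarrow> 'x) \<Rightarrow> ('p \<Rightarrow> 'y) \<Rightarrow>
    'x quandle \<Rightarrow> ('x \<Rightarrow> 'z) \<Rightarrow> 'y quandle \<Rightarrow> ('y \<Rightarrow> 'z) \<Rightarrow> bool" where
  "is_pullback P u v X p Y f \<longleftrightarrow> (\<lambda>a. (u a, v a)) \<in> quandle_iso P (pullback X p Y f)"

definition extension :: "'a quandle \<Rightarrow> 'b quandle \<Rightarrow> ('a \<Rightarrow> 'b) \<Rightarrow> bool" where
  "extension A B f \<longleftrightarrow> quandle A \<and> quandle B \<and> f \<in> quandle_hom A B \<and> f ` carrier A = carrier B"

definition trivial_extension :: "'a quandle \<Rightarrow> 'b quandle \<Rightarrow> ('a \<Rightarrow> 'b) \<Rightarrow> bool" where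
  "trivial_extension A B f \<longleftrightarrow> extension A B f \<and>
     is_pullback A f (pi0_unit A) B (pi0_unit B) (pi0 A) (pi0_map B f)"

text \<open>\<open>split_by B E p A f\<close>: the extension \<open>f : A \<rightarrow> B\<close> is split by \<open>p : E \<rightarrow> B\<close>.\<close>

definition split_by :: "'b quandle \<Rightarrow> 'e quandle \<Rightarrow> ('e \<Rightarrow> 'b) \<Rightarrow> 'a quandle \<Rightarrow> ('a \<Rightarrow> 'b) \<Rightarrow> bool" where
  "split_by B E p A f \<longleftrightarrow> extension E B p \<and> trivial_extension (pullback E p A f) E fst"

text \<open>HOL cannot quantify over the quandles on all types inside a formula. The two definitions
  below therefore let the quantified quandle range over the carriers in the type of formal terms
  over \<open>'b + nat\<close>. This is no restriction: by \<open>central_extensionI\<close> and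
  \<open>weakly_universal_split_by\<close> below, quandles on arbitrary types give the same notions.\<close>

datatype 'g qterm = Gen 'g | Op "'g qterm" "'g qterm" | OpInv "'g qterm" "'g qterm"

definition central_extension :: "'a quandle \<Rightarrow> 'b quandle \<Rightarrow> ('a \<Rightarrow> 'b) \<Rightarrow> bool" where
  "central_extension A B f \<longleftrightarrow> extension A B f \<and>
     (\<exists>(E :: ('b + nat) qterm quandle) p. split_by B E p A f)"

definition weakly_universal_central_extension ::
    "'t quandle \<Rightarrow> 'b quandle \<Rightarrow> ('t \<Rightarrow> 'b) \<Rightarrow> bool" where
  "weakly_universal_central_extension T B p \<longleftrightarrow> central_extension T B p \<and>
     (\<forall>(A :: ('b + nat) qterm quandle) f. central_extension A B f \<longrightarrow> split_by B T p A f)"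

subsection \<open>The congruence of a surjective homomorphism\<close>

definition covering_rel :: "'a quandle \<Rightarrow> ('a \<Rightarrow> 'b) \<Rightarrow> 'a rel" where
  "covering_rel A f = {(z \<triangleleft>\<^bsub>A\<^esub> x, z \<triangleleft>\<^bsub>A\<^esub> x') | z x x'.
     z \<in> carrier A \<and> x \<in> carrier A \<and> x' \<in> carrier A \<and> f x = f x'}"

definition covering_cong :: "'a quandle \<Rightarrow> ('a \<Rightarrow> 'b) \<Rightarrow> 'a rel" where
  "covering_cong A f = congruence_generated A (covering_rel A f)"

text \<open>The map induced by \<open>f\<close> on classes of a relation contained in \<open>Eq A f\<close>.\<close>

definition induced_map :: "('a \<Rightarrow> 'b) \<Rightarrow> 'a set \<Rightarrow> 'b" where
  "induced_map f X = the_elem (f ` X)"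

subsection \<open>Type independence of centrality and weak universality\<close>

definition step :: "'a quandle \<Rightarrow> 'a rel" where
  "step Q = {(x, y). x \<in> carrier Q \<and> (\<exists>b\<in>carrier Q. y = x \<triangleleft>\<^bsub>Q\<^esub> b \<or> y = x \<triangleleft>\<inverse>\<^bsub>Q\<^esub> b)}"

context quandle
begin

lemma Bij_translation: "b \<in> carrier Q \<Longrightarrow> right_translation Q b \<in> Bij (carrier Q)"
  unfolding Bij_def right_translation_def
  by (auto intro!: bij_betwI[where g = "\<lambda>a. a \<triangleleft>\<inverse> b"])

lemma inv_distrib:
  assumes "a \<in> carrier Q" "b \<in> carrier Q" "c \<in> carrier Q"
  shows "(a \<triangleleft>\<inverse> b) \<triangleleft> c = (a \<triangleleft> c) \<triangleleft>\<inverse> (b \<triangleleft> c)"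
proof -
  have "((a \<triangleleft>\<inverse> b) \<triangleleft> c) \<triangleleft> (b \<triangleleft> c) = a \<triangleleft> c"
    using assms distrib[of "a \<triangleleft>\<inverse> b" b c] by simp
  then have "a \<triangleleft> c \<triangleleft>\<inverse> (b \<triangleleft> c) = ((a \<triangleleft>\<inverse> b) \<triangleleft> c) \<triangleleft> (b \<triangleleft> c) \<triangleleft>\<inverse> (b \<triangleleft> c)" by simp
  also have "\<dots> = (a \<triangleleft>\<inverse> b) \<triangleleft> c" using assms by (intro op_inv) auto
  finally show ?thesis by simp
qed

lemma translation_Aut: "b \<in> carrier Q \<Longrightarrow> right_translation Q b \<in> carrier (Aut Q)"
  using Bij_translation
  by (auto simp: Aut_def quandle_hom_def right_translation_def intro: distrib inv_distrib)

lemma group_Aut: "group (Aut Q)"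
proof -
  interpret G: group "BijGroup (carrier Q)" by (rule group_BijGroup)
  have "subgroup (Bij (carrier Q) \<inter> quandle_hom Q Q) (BijGroup (carrier Q))"
  proof (rule G.subgroupI)
    show "Bij (carrier Q) \<inter> quandle_hom Q Q \<subseteq> carrier (BijGroup (carrier Q))"
      by (simp add: BijGroup_def)
    have "(\<lambda>x\<in>carrier Q. x) \<in> Bij (carrier Q) \<inter> quandle_hom Q Q"
      by (auto simp: id_Bij quandle_hom_def)
    then show "Bij (carrier Q) \<inter> quandle_hom Q Q \<noteq> {}" by blast
  next
    fix g assume g: "g \<in> Bij (carrier Q) \<inter> quandle_hom Q Q"
    then have bij: "bij_betw g (carrier Q) (carrier Q)" by (simp add: Bij_def)
    let ?h = "inv_into (carrier Q) g"
    have r: "?h x \<in> carrier Q" "g (?h x) = x" if "x \<in> carrier Q" for x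
      using bij that by (auto simp: bij_betw_def inv_into_into f_inv_into_f)
    have l: "?h (g x) = x" if "x \<in> carrier Q" for x
      using bij that by (auto simp: bij_betw_def)
    have hom: "g (x \<triangleleft> y) = g x \<triangleleft> g y" "g (x \<triangleleft>\<inverse> y) = g x \<triangleleft>\<inverse> g y"
      if "x \<in> carrier Q" "y \<in> carrier Q" for x y
      using g that by (auto simp: quandle_hom_def)
    have "?h (x \<triangleleft> y) = ?h x \<triangleleft> ?h y \<and> ?h (x \<triangleleft>\<inverse> y) = ?h x \<triangleleft>\<inverse> ?h y"
      if "x \<in> carrier Q" "y \<in> carrier Q" for x y
      using hom[of "?h x" "?h y"] r that l[of "?h x \<triangleleft> ?h y"] l[of "?h x \<triangleleft>\<inverse> ?h y"] by simp
    then show "inv\<^bsub>BijGroup (carrier Q)\<^esub> g \<in> Bij (carrier Q) \<inter> quandle_hom Q Q"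
      using g r by (auto simp: inv_BijGroup restrict_inv_into_Bij quandle_hom_def)
  next
    fix g h assume "g \<in> Bij (carrier Q) \<inter> quandle_hom Q Q" "h \<in> Bij (carrier Q) \<inter> quandle_hom Q Q"
    moreover from this have "compose (carrier Q) g h \<in> Bij (carrier Q)" by (auto intro: compose_Bij)
    moreover have "compose (carrier Q) g h \<in> quandle_hom Q Q"
      using calculation(1,2) by (simp add: quandle_hom_def compose_def Pi_iff)
    ultimately show "g \<otimes>\<^bsub>BijGroup (carrier Q)\<^esub> h \<in> Bij (carrier Q) \<inter> quandle_hom Q Q"
      by (simp add: BijGroup_def)
  qed
  then show ?thesis unfolding Aut_def by (rule G.subgroup_imp_group)
qed

lemma Aut_mult: "\<lbrakk>g \<in> carrier (Aut Q); h \<in> carrier (Aut Q)\<rbrakk> \<Longrightarrow> g \<otimes>\<^bsub>Aut Q\<^esub> h = compose (carrier Q) g h"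
  by (simp add: Aut_def BijGroup_def)

lemma Aut_one: "\<one>\<^bsub>Aut Q\<^esub> = (\<lambda>x\<in>carrier Q. x)"
  by (simp add: Aut_def BijGroup_def)

lemma inv_translation:
  assumes b: "b \<in> carrier Q" and a: "a \<in> carrier Q"
  shows "(inv\<^bsub>Aut Q\<^esub> (right_translation Q b)) a = a \<triangleleft>\<inverse> b"
proof -
  interpret G: group "Aut Q" by (rule group_Aut)
  let ?i = "inv\<^bsub>Aut Q\<^esub> (right_translation Q b)"
  have "?i \<otimes>\<^bsub>Aut Q\<^esub> right_translation Q b = \<one>\<^bsub>Aut Q\<^esub>"
    using translation_Aut[OF b] by simp
  then have "compose (carrier Q) ?i (right_translation Q b) (a \<triangleleft>\<inverse> b) = (\<lambda>x\<in>carrier Q. x) (a \<triangleleft>\<inverse> b)"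
    using translation_Aut[OF b] by (simp add: Aut_mult Aut_one)
  then show ?thesis using a b by (simp add: compose_def right_translation_def)
qed

lemma step_closed: "(x, y) \<in> (step Q)\<^sup>* \<Longrightarrow> x \<in> carrier Q \<Longrightarrow> y \<in> carrier Q"
  by (induction rule: rtrancl_induct) (auto simp: step_def)

lemma step_sym: "(x, y) \<in> step Q \<Longrightarrow> (y, x) \<in> step Q"
  unfolding step_def by (clarsimp, elim bexE disjE) (use op_inv inv_op op_closed inv_closed in metis)+

lemma Inn_Aut: "Inn Q \<subseteq> carrier (Aut Q)"
  unfolding Inn_def by (rule group.generate_incl[OF group_Aut]) (use translation_Aut in blast)

lemma Inn_step:
  assumes "g \<in> Inn Q" "a \<in> carrier Q"
  shows "(a, g a) \<in> (step Q)\<^sup>*"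
  using assms unfolding Inn_def
proof (induction arbitrary: a rule: generate.induct)
  case one
  then show ?case by (simp add: Aut_one)
next
  case (incl h)
  then show ?case by (auto simp: right_translation_def step_def intro!: r_into_rtrancl)
next
  case (inv h)
  then show ?case by (auto simp: inv_translation step_def intro!: r_into_rtrancl)
next
  case (eng g h)
  have *: "g \<in> carrier (Aut Q)" "h \<in> carrier (Aut Q)"
    using eng Inn_Aut unfolding Inn_def by auto
  then have "h a \<in> carrier Q" using eng.prems by (auto simp: Aut_def quandle_hom_def)
  then show ?case using eng * by (simp add: Aut_mult compose_def) (meson rtrancl_trans)
qed

lemma step_Inn: "(a, a') \<in> (step Q)\<^sup>* \<Longrightarrow> a \<in> carrier Q \<Longrightarrow> \<exists>g\<in>Inn Q. g a = a'"
proof (induction rule: rtrancl_induct)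
  case base
  then show ?case unfolding Inn_def
    by (intro bexI[of _ "\<one>\<^bsub>Aut Q\<^esub>"] generate.one) (simp add: Aut_one)
next
  case (step y z)
  then obtain g where g: "g \<in> Inn Q" "g a = y" by blast
  obtain b where b: "b \<in> carrier Q" "z = y \<triangleleft> b \<or> z = y \<triangleleft>\<inverse> b" and y: "y \<in> carrier Q"
    using step by (auto simp: step_def)
  interpret G: group "Aut Q" by (rule group_Aut)
  let ?t = "right_translation Q b"
  have t: "?t \<in> Inn Q" "inv\<^bsub>Aut Q\<^esub> ?t \<in> Inn Q"
    using b unfolding Inn_def by (auto intro: generate.incl generate.inv)
  have c: "k \<otimes>\<^bsub>Aut Q\<^esub> g \<in> Inn Q" "(k \<otimes>\<^bsub>Aut Q\<^esub> g) a = k y" if "k \<in> Inn Q" for k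
  proof -
    show "k \<otimes>\<^bsub>Aut Q\<^esub> g \<in> Inn Q" using that g unfolding Inn_def by (auto intro: generate.eng)
    have "k \<in> carrier (Aut Q)" "g \<in> carrier (Aut Q)" using Inn_Aut that g by auto
    then show "(k \<otimes>\<^bsub>Aut Q\<^esub> g) a = k y" using g step.prems by (simp add: Aut_mult compose_def)
  qed
  from b(2) show ?case
  proof
    assume "z = y \<triangleleft> b"
    then show ?thesis using c[OF t(1)] y by (intro bexI[of _ "?t \<otimes>\<^bsub>Aut Q\<^esub> g"]) (auto simp: right_translation_def)
  next
    assume "z = y \<triangleleft>\<inverse> b"
    then show ?thesis using c[OF t(2)] y b inv_translation[OF b(1) y]
      by (intro bexI[of _ "inv\<^bsub>Aut Q\<^esub> ?t \<otimes>\<^bsub>Aut Q\<^esub> g"]) auto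
  qed
qed

lemma inn_rel_iff: "(a, a') \<in> inn_rel Q \<longleftrightarrow> a \<in> carrier Q \<and> (a, a') \<in> (step Q)\<^sup>*"
  unfolding inn_rel_def using Inn_step step_Inn step_closed by auto

lemma equiv_inn_rel: "equiv (carrier Q) (inn_rel Q)"
proof (rule equivI)
  show "inn_rel Q \<subseteq> carrier Q \<times> carrier Q" by (auto simp: inn_rel_def)
  show "refl_on (carrier Q) (inn_rel Q)" by (auto simp: refl_on_def inn_rel_iff)
  have "sym ((step Q)\<^sup>*)" by (rule sym_rtrancl) (auto simp: sym_def intro: step_sym)
  then show "sym (inn_rel Q)" by (auto simp: sym_def inn_rel_iff intro: step_closed)
  show "trans (inn_rel Q)" by (auto simp: trans_def inn_rel_iff intro: rtrancl_trans)
qed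

end

lemma quandle_homD:
  assumes "h \<in> quandle_hom X Y" "x \<in> carrier X"
  shows "h x \<in> carrier Y"
    and "y \<in> carrier X \<Longrightarrow> h (x \<triangleleft>\<^bsub>X\<^esub> y) = h x \<triangleleft>\<^bsub>Y\<^esub> h y"
    and "y \<in> carrier X \<Longrightarrow> h (x \<triangleleft>\<inverse>\<^bsub>X\<^esub> y) = h x \<triangleleft>\<inverse>\<^bsub>Y\<^esub> h y"
  using assms by (auto simp: quandle_hom_def)

lemma extensionD:
  assumes "extension A B f"
  shows "quandle A" "quandle B" "f \<in> quandle_hom A B" "f ` carrier A = carrier B"
  using assms by (auto simp: extension_def)

lemma extension_comp:
  assumes "extension A B f" "quandle A'" "h \<in> quandle_hom A' A"
    and "carrier B \<subseteq> f ` h ` carrier A'"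
  shows "extension A' B (f \<circ> h)"
proof -
  note f = extensionD[OF assms(1)]
  have "f \<circ> h \<in> quandle_hom A' B"
    using quandle_homD[OF f(3)] quandle_homD[OF assms(3)] by (auto simp: quandle_hom_def)
  then show ?thesis
    using assms f by (auto simp: extension_def quandle_hom_def image_comp)
qed

lemma pullback_carrier: "carrier (pullback X p Y f) = {(x, y) \<in> carrier X \<times> carrier Y. p x = f y}"
  by (simp add: pullback_def)

lemma pullback_ops:
  "(x, y) \<triangleleft>\<^bsub>pullback X p Y f\<^esub> (x', y') = (x \<triangleleft>\<^bsub>X\<^esub> x', y \<triangleleft>\<^bsub>Y\<^esub> y')"
  "(x, y) \<triangleleft>\<inverse>\<^bsub>pullback X p Y f\<^esub> (x', y') = (x \<triangleleft>\<inverse>\<^bsub>X\<^esub> x', y \<triangleleft>\<inverse>\<^bsub>Y\<^esub> y')"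
  by (simp_all add: pullback_def prod_quandle_def)

lemma quandle_pullback:
  assumes "extension E B p" "extension A B f"
  shows "quandle (pullback E p A f)"
proof -
  note p = extensionD[OF assms(1)] and f = extensionD[OF assms(2)]
  interpret E: quandle E by fact
  interpret A: quandle A by fact
  have hp: "p (x \<triangleleft>\<^bsub>E\<^esub> y) = p x \<triangleleft>\<^bsub>B\<^esub> p y" "p (x \<triangleleft>\<inverse>\<^bsub>E\<^esub> y) = p x \<triangleleft>\<inverse>\<^bsub>B\<^esub> p y"
    if "x \<in> carrier E" "y \<in> carrier E" for x y using quandle_homD[OF p(3)] that by auto
  have hf: "f (x \<triangleleft>\<^bsub>A\<^esub> y) = f x \<triangleleft>\<^bsub>B\<^esub> f y" "f (x \<triangleleft>\<inverse>\<^bsub>A\<^esub> y) = f x \<triangleleft>\<inverse>\<^bsub>B\<^esub> f y"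
    if "x \<in> carrier A" "y \<in> carrier A" for x y using quandle_homD[OF f(3)] that by auto
  show ?thesis
    by unfold_locales
      (auto simp: pullback_carrier pullback_ops hp hf E.idem A.idem intro: E.distrib A.distrib)
qed

lemma extension_fst:
  assumes "extension E B p" "extension A B f"
  shows "extension (pullback E p A f) E fst"
proof -
  note p = extensionD[OF assms(1)] and f = extensionD[OF assms(2)]
  have "fst ` carrier (pullback E p A f) = carrier E"
  proof
    show "carrier E \<subseteq> fst ` carrier (pullback E p A f)"
    proof
      fix e assume e: "e \<in> carrier E"
      then obtain a where "a \<in> carrier A" "f a = p e"
        using quandle_homD(1)[OF p(3) e] f(4) by (metis imageE)
      then show "e \<in> fst ` carrier (pullback E p A f)"
        using e by (force simp: pullback_carrier)
    qed
  qed (auto simp: pullback_carrier)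
  then show ?thesis
    using quandle_pullback[OF assms] p(1)
    by (auto simp: extension_def quandle_hom_def pullback_carrier pullback_ops)
qed

lemma hom_step:
  assumes "h \<in> quandle_hom X Y" "(x, y) \<in> (step X)\<^sup>*"
  shows "(h x, h y) \<in> (step Y)\<^sup>*"
  using assms(2)
proof (induction rule: rtrancl_induct)
  case (step y z)
  then have "(h y, h z) \<in> step Y"
    using quandle_homD[OF assms(1)] by (auto simp: step_def)
  then show ?case using step by (meson rtrancl.rtrancl_into_rtrancl)
qed simp

lemma hom_inn_rel:
  assumes "quandle X" "quandle Y" "h \<in> quandle_hom X Y" "(x, y) \<in> inn_rel X"
  shows "(h x, h y) \<in> inn_rel Y"
  using assms hom_step[OF assms(3)] quandle_homD(1)[OF assms(3)]
  by (simp add: quandle.inn_rel_iff)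

lemma lift_step:
  assumes "extension A B f" "a \<in> carrier A" "(f a, b) \<in> (step B)\<^sup>*"
  shows "\<exists>a'\<in>carrier A. f a' = b \<and> (a, a') \<in> (step A)\<^sup>*"
  using assms(3)
proof (induction rule: rtrancl_induct)
  case base
  then show ?case using assms(2) by auto
next
  case (step y z)
  note f = extensionD[OF assms(1)]
  obtain a' where a': "a' \<in> carrier A" "f a' = y" "(a, a') \<in> (step A)\<^sup>*" using step by auto
  obtain b where b: "b \<in> carrier B" "z = y \<triangleleft>\<^bsub>B\<^esub> b \<or> z = y \<triangleleft>\<inverse>\<^bsub>B\<^esub> b"
    using step by (auto simp: step_def)
  obtain x where x: "x \<in> carrier A" "f x = b" using b(1) f(4) by (metis imageE)
  let ?z = "if z = y \<triangleleft>\<^bsub>B\<^esub> b then a' \<triangleleft>\<^bsub>A\<^esub> x else a' \<triangleleft>\<inverse>\<^bsub>A\<^esub> x"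
  have "?z \<in> carrier A" using a' x f(1) by (simp add: quandle.op_closed quandle.inv_closed)
  moreover have "f ?z = z" using a' x b quandle_homD[OF f(3)] by auto
  moreover have "(a', ?z) \<in> step A" using a' x by (auto simp: step_def)
  ultimately show ?case using rtrancl_into_rtrancl[OF a'(3)] by blast
qed

lemma trivial_extension_iff:
  assumes "extension A B f"
  shows "trivial_extension A B f \<longleftrightarrow> (\<forall>a a'. (a, a') \<in> inn_rel A \<and> f a = f a' \<longrightarrow> a = a')"
proof -
  note f = extensionD[OF assms]
  interpret A: quandle A by fact
  interpret B: quandle B by fact
  have unit_eq: "pi0_unit A a = pi0_unit A a' \<longleftrightarrow> (a, a') \<in> inn_rel A"
    if "a \<in> carrier A" "a' \<in> carrier A" for a a'
    unfolding pi0_unit_def by (rule eq_equiv_class_iff[OF A.equiv_inn_rel that])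
  have unit_eqB: "pi0_unit B b = pi0_unit B b' \<longleftrightarrow> (b, b') \<in> inn_rel B"
    if "b \<in> carrier B" "b' \<in> carrier B" for b b'
    unfolding pi0_unit_def by (rule eq_equiv_class_iff[OF B.equiv_inn_rel that])
  have map: "pi0_map B f (pi0_unit A a) = pi0_unit B (f a)" if a: "a \<in> carrier A" for a
  proof -
    have "pi0_unit B (f a') = pi0_unit B (f a)" if "a' \<in> pi0_unit A a" for a'
    proof -
      have r: "(a, a') \<in> inn_rel A" using that by (simp add: pi0_unit_def)
      then have "a' \<in> carrier A" by (simp add: inn_rel_def)
      then show ?thesis
        using hom_inn_rel[OF f(1-3) r] unit_eqB quandle_homD(1)[OF f(3)] a by metis
    qed
    moreover have "a \<in> pi0_unit A a" using a by (simp add: pi0_unit_def A.inn_rel_iff)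
    ultimately have "(\<lambda>a. pi0_unit B (f a)) ` pi0_unit A a = {pi0_unit B (f a)}" by blast
    then show ?thesis by (simp add: pi0_map_def)
  qed
  let ?P = "pullback B (pi0_unit B) (pi0 A) (pi0_map B f)" and ?h = "\<lambda>a. (f a, pi0_unit A a)"
  have cP: "carrier ?P = {(b, X). b \<in> carrier B \<and> X \<in> carrier A // inn_rel A \<and> pi0_unit B b = pi0_map B f X}"
    by (auto simp: pullback_carrier pi0_def trivial_quandle_def)
  have triv: "pi0_unit A (a \<triangleleft>\<^bsub>A\<^esub> a') = pi0_unit A a" "pi0_unit A (a \<triangleleft>\<inverse>\<^bsub>A\<^esub> a') = pi0_unit A a"
    if "a \<in> carrier A" "a' \<in> carrier A" for a a'
  proof -
    have "(a, a \<triangleleft>\<^bsub>A\<^esub> a') \<in> inn_rel A" "(a, a \<triangleleft>\<inverse>\<^bsub>A\<^esub> a') \<in> inn_rel A"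
      using that by (auto simp: A.inn_rel_iff step_def intro!: r_into_rtrancl)
    then show "pi0_unit A (a \<triangleleft>\<^bsub>A\<^esub> a') = pi0_unit A a" "pi0_unit A (a \<triangleleft>\<inverse>\<^bsub>A\<^esub> a') = pi0_unit A a"
      using unit_eq that A.op_closed A.inv_closed by metis+
  qed
  have hc: "?h a \<in> carrier ?P" if "a \<in> carrier A" for a
  proof -
    have "pi0_unit A a \<in> carrier A // inn_rel A" using that by (simp add: pi0_unit_def quotientI)
    then show ?thesis using that quandle_homD(1)[OF f(3)] by (simp add: cP map)
  qed
  have hom: "?h \<in> quandle_hom A ?P"
    using hc quandle_homD[OF f(3)]
    by (auto simp: quandle_hom_def pullback_ops triv pi0_def trivial_quandle_def)
  have "carrier ?P \<subseteq> ?h ` carrier A"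
  proof
    fix u assume "u \<in> carrier ?P"
    then obtain b a where u: "u = (b, pi0_unit A a)" "b \<in> carrier B" "a \<in> carrier A"
      "pi0_unit B b = pi0_map B f (pi0_unit A a)"
      by (auto simp: cP quotient_def pi0_unit_def)
    then have "pi0_unit B (f a) = pi0_unit B b" using map by simp
    then have "(f a, b) \<in> (step B)\<^sup>*" using unit_eqB u quandle_homD(1)[OF f(3)] B.inn_rel_iff by metis
    from lift_step[OF assms u(3) this] obtain a' where a': "a' \<in> carrier A" "f a' = b" "(a, a') \<in> inn_rel A"
      using u by (auto simp: A.inn_rel_iff)
    then have "pi0_unit A a' = pi0_unit A a" using unit_eq u by metis
    then show "u \<in> ?h ` carrier A" using u a' by auto
  qed
  then have surj: "?h ` carrier A = carrier ?P" using hc by auto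
  have "trivial_extension A B f \<longleftrightarrow> inj_on ?h (carrier A)"
    using assms hom surj by (auto simp: trivial_extension_def is_pullback_def quandle_iso_def bij_betw_def)
  also have "\<dots> \<longleftrightarrow> (\<forall>a a'. (a, a') \<in> inn_rel A \<and> f a = f a' \<longrightarrow> a = a')"
  proof -
    have "a \<in> carrier A \<and> a' \<in> carrier A" if "(a, a') \<in> inn_rel A" for a a'
      using that by (simp add: inn_rel_def)
    then show ?thesis unfolding inj_on_def using unit_eq by (metis Pair_inject)
  qed
  finally show ?thesis .
qed

lemma split_by_iff:
  assumes "extension A B f"
  shows "split_by B E p A f \<longleftrightarrow> extension E B p \<and>
    (\<forall>e a a'. ((e, a), (e, a')) \<in> inn_rel (pullback E p A f) \<longrightarrow> a = a')"
  using trivial_extension_iff[OF extension_fst[OF _ assms]] by (fastforce simp: split_by_def)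

lemma split_byD:
  assumes "extension A B f" "split_by B E p A f" "((e, a), (e, a')) \<in> inn_rel (pullback E p A f)"
  shows "a = a'"
  using assms(2)[unfolded split_by_iff[OF assms(1)]] assms(3) by metis

lemma split_by_comp:
  assumes A: "extension A B f" and s: "split_by B E p A f"
    and h: "h \<in> quandle_hom E' E" and E': "extension E' B (p \<circ> h)"
  shows "split_by B E' (p \<circ> h) A f"
proof -
  have E: "extension E B p" using s by (simp add: split_by_def)
  have "map_prod h id \<in> quandle_hom (pullback E' (p \<circ> h) A f) (pullback E p A f)"
    using quandle_homD[OF h] by (auto simp: quandle_hom_def pullback_carrier pullback_ops)
  note m = hom_inn_rel[OF quandle_pullback[OF E' A] quandle_pullback[OF E A] this]
  show ?thesis
    unfolding split_by_iff[OF A] using s[unfolded split_by_iff[OF A]] E' m by fastforce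
qed

lemma split_by_sub:
  assumes A: "extension A B f" and s: "split_by B E p A f"
    and h: "h \<in> quandle_hom A' A" "inj_on h (carrier A')" and A': "extension A' B (f \<circ> h)"
  shows "split_by B E p A' (f \<circ> h)"
proof -
  have E: "extension E B p" using s by (simp add: split_by_def)
  have "map_prod id h \<in> quandle_hom (pullback E p A' (f \<circ> h)) (pullback E p A f)"
    using quandle_homD[OF h(1)] by (auto simp: quandle_hom_def pullback_carrier pullback_ops)
  note m = hom_inn_rel[OF quandle_pullback[OF E A'] quandle_pullback[OF E A] this]
  have "a = a'" if r: "((e, a), (e, a')) \<in> inn_rel (pullback E p A' (f \<circ> h))" for e a a'
  proof -
    have "h a = h a'" using m[OF r] s[unfolded split_by_iff[OF A]] by auto
    moreover have "a \<in> carrier A'" "a' \<in> carrier A'" using r by (auto simp: inn_rel_def pullback_carrier)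
    ultimately show ?thesis using h(2) by (simp add: inj_on_def)
  qed
  then show ?thesis unfolding split_by_iff[OF A'] using E by blast
qed

primrec qeval :: "'x quandle \<Rightarrow> ('g \<Rightarrow> 'x) \<Rightarrow> 'g qterm \<Rightarrow> 'x" where
  "qeval X g (Gen i) = g i"
| "qeval X g (Op s t) = qeval X g s \<triangleleft>\<^bsub>X\<^esub> qeval X g t"
| "qeval X g (OpInv s t) = qeval X g s \<triangleleft>\<inverse>\<^bsub>X\<^esub> qeval X g t"

lemma generated_subquandle:
  fixes g :: "'g \<Rightarrow> 'x"
  assumes X: "quandle X" and g: "g ` I \<subseteq> carrier X"
  shows "\<exists>(Y :: 'g qterm quandle) h. quandle Y \<and> h \<in> quandle_hom Y X \<and>
    inj_on h (carrier Y) \<and> g ` I \<subseteq> h ` carrier Y"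
proof -
  interpret X: quandle X by fact
  define T where "T = {t. set_qterm t \<subseteq> I}"
  define h where "h = qeval X g"
  define r where "r = inv_into T h"
  define Y where "Y = \<lparr>carrier = r ` h ` T, qop = (\<lambda>s t. r (h s \<triangleleft>\<^bsub>X\<^esub> h t)),
    qinv = (\<lambda>s t. r (h s \<triangleleft>\<inverse>\<^bsub>X\<^esub> h t))\<rparr>"
  have hX: "h t \<in> carrier X" if "t \<in> T" for t
    using that g unfolding T_def h_def by (induction t) auto
  have hr: "h (r x) = x" "r x \<in> T" if "x \<in> h ` T" for x
    using that by (auto simp: r_def f_inv_into_f inv_into_into)
  have cl: "h s \<triangleleft>\<^bsub>X\<^esub> h t \<in> h ` T" "h s \<triangleleft>\<inverse>\<^bsub>X\<^esub> h t \<in> h ` T" if "s \<in> T" "t \<in> T" for s t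
  proof -
    have "Op s t \<in> T" "OpInv s t \<in> T" using that by (auto simp: T_def)
    moreover have "h (Op s t) = h s \<triangleleft>\<^bsub>X\<^esub> h t" "h (OpInv s t) = h s \<triangleleft>\<inverse>\<^bsub>X\<^esub> h t" by (auto simp: h_def)
    ultimately show "h s \<triangleleft>\<^bsub>X\<^esub> h t \<in> h ` T" "h s \<triangleleft>\<inverse>\<^bsub>X\<^esub> h t \<in> h ` T" by (metis imageI)+
  qed
  have Y: "carrier Y = r ` h ` T" "s \<triangleleft>\<^bsub>Y\<^esub> t = r (h s \<triangleleft>\<^bsub>X\<^esub> h t)" "s \<triangleleft>\<inverse>\<^bsub>Y\<^esub> t = r (h s \<triangleleft>\<inverse>\<^bsub>X\<^esub> h t)" for s t
    by (auto simp: Y_def)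
  have YT: "t \<in> T" "h t \<in> carrier X" "r (h t) = t" if "t \<in> carrier Y" for t
    using that hr hX by (auto simp: Y)
  have hop: "h (s \<triangleleft>\<^bsub>Y\<^esub> t) = h s \<triangleleft>\<^bsub>X\<^esub> h t" "h (s \<triangleleft>\<inverse>\<^bsub>Y\<^esub> t) = h s \<triangleleft>\<inverse>\<^bsub>X\<^esub> h t"
    "s \<triangleleft>\<^bsub>Y\<^esub> t \<in> carrier Y" "s \<triangleleft>\<inverse>\<^bsub>Y\<^esub> t \<in> carrier Y"
    if "s \<in> carrier Y" "t \<in> carrier Y" for s t
    using cl[OF YT(1)[OF that(1)] YT(1)[OF that(2)]] hr by (auto simp: Y)
  have inj: "inj_on h (carrier Y)" by (rule inj_on_inverseI[of _ r]) (rule YT)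
  have eqI: "s = t" if "h s = h t" "s \<in> carrier Y" "t \<in> carrier Y" for s t
    using inj that by (simp add: inj_on_def)
  have "quandle Y"
    by unfold_locales (auto simp: hop YT X.idem intro!: eqI X.distrib)
  moreover have "h \<in> quandle_hom Y X" by (auto simp: quandle_hom_def hop YT)
  moreover have "g ` I \<subseteq> h ` carrier Y"
  proof
    fix x assume "x \<in> g ` I"
    then obtain i where "i \<in> I" "x = g i" by auto
    then have "Gen i \<in> T" "h (Gen i) = x" by (auto simp: T_def h_def)
    then have x: "x \<in> h ` T" by (metis imageI)
    then have "x = h (r x)" "r x \<in> carrier Y" using hr by (auto simp: Y)
    then show "x \<in> h ` carrier Y" by blast
  qed
  ultimately show ?thesis using inj by blast
qed

lemma small_subextension:
  fixes A :: "'a quandle" and B :: "'b quandle"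
  assumes f: "extension A B f" and F: "finite F" "F \<subseteq> carrier A"
  shows "\<exists>(Y :: ('b + nat) qterm quandle) h. quandle Y \<and> h \<in> quandle_hom Y A \<and>
    inj_on h (carrier Y) \<and> F \<subseteq> h ` carrier Y \<and> extension Y B (f \<circ> h)"
proof -
  obtain s where s: "s b \<in> carrier A" "f (s b) = b" if "b \<in> carrier B" for b
    using extensionD(4)[OF f] by (metis (no_types, lifting) image_iff)
  obtain n k where k: "F = k ` {i::nat. i < n}"
    using F(1) by (auto simp: finite_conv_nat_seg_image)
  define g where "g = case_sum s k"
  let ?I = "Inl ` carrier B \<union> Inr ` {i::nat. i < n}"
  have gI: "g ` ?I = s ` carrier B \<union> F" by (simp add: g_def k image_Un image_image)
  have "g ` ?I \<subseteq> carrier A" unfolding gI using s F by auto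
  from generated_subquandle[OF extensionD(1)[OF f] this]
  obtain Y :: "('b + nat) qterm quandle" and h where Y: "quandle Y" "h \<in> quandle_hom Y A"
    "inj_on h (carrier Y)" "g ` ?I \<subseteq> h ` carrier Y" by blast
  have "carrier B \<subseteq> f ` h ` carrier Y"
  proof
    fix b assume "b \<in> carrier B"
    then have "s b \<in> h ` carrier Y" "f (s b) = b" using Y(4) gI s by auto
    then show "b \<in> f ` h ` carrier Y" by (metis imageI)
  qed
  note ext = extension_comp[OF f Y(1,2) this]
  have "F \<subseteq> h ` carrier Y" using Y(4) unfolding gI by simp
  then show ?thesis using ext Y(1-3) by (intro exI[of _ Y] exI[of _ h]) simp
qed

theorem central_extensionI:
  assumes "extension A B f" "split_by B E p A f"
  shows "central_extension A B f"
proof -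
  have "extension E B p" using assms(2) by (simp add: split_by_def)
  from small_subextension[OF this, of "{}"] show ?thesis
    using assms split_by_comp[OF assms] unfolding central_extension_def by blast
qed

lemma lift_path:
  assumes "(u, v) \<in> (step (pullback T p A f))\<^sup>*"
  shows "\<exists>F. finite F \<and> F \<subseteq> carrier A \<and>
    (\<forall>(Y :: 'y quandle) h x. quandle Y \<and> h \<in> quandle_hom Y A \<and> F \<subseteq> h ` carrier Y \<and>
       x \<in> carrier Y \<and> h x = snd u \<longrightarrow>
       (\<exists>y\<in>carrier Y. h y = snd v \<and> ((fst u, x), (fst v, y)) \<in> (step (pullback T p Y (f \<circ> h)))\<^sup>*))"
  using assms
proof (induction rule: rtrancl_induct)
  case base
  show ?case by (rule exI[of _ "{}"]) (simp, blast)
next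
  case (step v w)
  from step.IH obtain F where F: "finite F" "F \<subseteq> carrier A"
    and lift: "\<forall>(Y :: 'y quandle) h x. quandle Y \<and> h \<in> quandle_hom Y A \<and> F \<subseteq> h ` carrier Y \<and>
       x \<in> carrier Y \<and> h x = snd u \<longrightarrow>
       (\<exists>y\<in>carrier Y. h y = snd v \<and> ((fst u, x), (fst v, y)) \<in> (step (pullback T p Y (f \<circ> h)))\<^sup>*)"
    by (elim exE conjE) (rule that)
  obtain t0 a0 where v: "v = (t0, a0)" by (cases v)
  obtain t a where ta: "t \<in> carrier T" "a \<in> carrier A" "p t = f a"
    "w = (t0 \<triangleleft>\<^bsub>T\<^esub> t, a0 \<triangleleft>\<^bsub>A\<^esub> a) \<or> w = (t0 \<triangleleft>\<inverse>\<^bsub>T\<^esub> t, a0 \<triangleleft>\<inverse>\<^bsub>A\<^esub> a)"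
    and vc: "t0 \<in> carrier T" "a0 \<in> carrier A" "p t0 = f a0"
    using step.hyps(2) by (auto simp: step_def pullback_carrier pullback_ops v)
  have "\<exists>y\<in>carrier Y. h y = snd w \<and> ((fst u, x), (fst w, y)) \<in> (step (pullback T p Y (f \<circ> h)))\<^sup>*"
    if Y: "quandle Y" "h \<in> quandle_hom Y A" "insert a F \<subseteq> h ` carrier Y" "x \<in> carrier Y" "h x = snd u"
    for Y :: "'y quandle" and h x
  proof -
    interpret Y: quandle Y by fact
    obtain y where y: "y \<in> carrier Y" "h y = a0"
      "((fst u, x), (t0, y)) \<in> (step (pullback T p Y (f \<circ> h)))\<^sup>*"
      using lift[rule_format, of Y h x] Y v by (auto simp del: comp_apply)
    obtain z where z: "z \<in> carrier Y" "h z = a" using Y(3) by auto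
    have c: "(t0, y) \<in> carrier (pullback T p Y (f \<circ> h))" "(t, z) \<in> carrier (pullback T p Y (f \<circ> h))"
      using y z vc ta by (auto simp: pullback_carrier)
    from ta(4) show ?thesis
    proof
      assume w: "w = (t0 \<triangleleft>\<^bsub>T\<^esub> t, a0 \<triangleleft>\<^bsub>A\<^esub> a)"
      have "((t0, y), (fst w, y \<triangleleft>\<^bsub>Y\<^esub> z)) \<in> step (pullback T p Y (f \<circ> h))"
        using c unfolding step_def by (auto intro!: bexI[of _ "(t, z)"] simp: pullback_ops w)
      moreover have "h (y \<triangleleft>\<^bsub>Y\<^esub> z) = snd w" using quandle_homD(2)[OF Y(2)] y z w by simp
      ultimately show ?thesis using y z
        by (intro bexI[of _ "y \<triangleleft>\<^bsub>Y\<^esub> z"]) (auto intro: rtrancl_into_rtrancl)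
    next
      assume w: "w = (t0 \<triangleleft>\<inverse>\<^bsub>T\<^esub> t, a0 \<triangleleft>\<inverse>\<^bsub>A\<^esub> a)"
      have "((t0, y), (fst w, y \<triangleleft>\<inverse>\<^bsub>Y\<^esub> z)) \<in> step (pullback T p Y (f \<circ> h))"
        using c unfolding step_def by (auto intro!: bexI[of _ "(t, z)"] simp: pullback_ops w)
      moreover have "h (y \<triangleleft>\<inverse>\<^bsub>Y\<^esub> z) = snd w" using quandle_homD(3)[OF Y(2)] y z w by simp
      ultimately show ?thesis using y z
        by (intro bexI[of _ "y \<triangleleft>\<inverse>\<^bsub>Y\<^esub> z"]) (auto intro: rtrancl_into_rtrancl)
    qed
  qed
  moreover have "finite (insert a F)" "insert a F \<subseteq> carrier A" using F(1,2) ta(2) by auto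
  ultimately show ?case by (intro exI[of _ "insert a F"] conjI allI impI) (assumption | elim conjE)+
qed

theorem weakly_universal_split_by:
  fixes A :: "'a quandle" and B :: "'b quandle"
  assumes w: "weakly_universal_central_extension T B p" and c: "central_extension A B f"
  shows "split_by B T p A f"
proof -
  have T: "extension T B p" using w
    by (simp add: weakly_universal_central_extension_def central_extension_def)
  have f: "extension A B f" using c by (simp add: central_extension_def)
  obtain E :: "('b + nat) qterm quandle" and e where E: "split_by B E e A f"
    using c by (auto simp: central_extension_def)
  have "a = a'" if r: "((t, a), (t, a')) \<in> inn_rel (pullback T p A f)" for t a a'
  proof -
    have car: "t \<in> carrier T" "a \<in> carrier A" "p t = f a" using r by (auto simp: inn_rel_def pullback_carrier)
    have "((t, a), (t, a')) \<in> (step (pullback T p A f))\<^sup>*"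
      using r quandle.inn_rel_iff[OF quandle_pullback[OF T f]] by auto
    from lift_path[where 'y = "('b + nat) qterm", OF this] obtain F where F: "finite F" "F \<subseteq> carrier A"
      "\<And>(Y :: ('b + nat) qterm quandle) h x. \<lbrakk>quandle Y; h \<in> quandle_hom Y A; F \<subseteq> h ` carrier Y;
         x \<in> carrier Y; h x = a\<rbrakk> \<Longrightarrow>
         \<exists>y\<in>carrier Y. h y = a' \<and> ((t, x), (t, y)) \<in> (step (pullback T p Y (f \<circ> h)))\<^sup>*"
      by auto
    from small_subextension[OF f, of "insert a F"] F car
    obtain Y :: "('b + nat) qterm quandle" and h where Y: "quandle Y" "h \<in> quandle_hom Y A"
      "inj_on h (carrier Y)" "insert a F \<subseteq> h ` carrier Y" "extension Y B (f \<circ> h)" by auto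
    obtain x where x: "x \<in> carrier Y" "h x = a" using Y(4) by auto
    obtain y where y: "y \<in> carrier Y" "h y = a'" "((t, x), (t, y)) \<in> (step (pullback T p Y (f \<circ> h)))\<^sup>*"
      using F(3)[OF Y(1,2) _ x] Y(4) by auto
    have "central_extension Y B (f \<circ> h)"
      by (rule central_extensionI[OF Y(5) split_by_sub[OF f E Y(2,3,5)]])
    then have "split_by B T p Y (f \<circ> h)"
      using w by (simp add: weakly_universal_central_extension_def)
    moreover have "((t, x), (t, y)) \<in> inn_rel (pullback T p Y (f \<circ> h))"
      using y(3) car x quandle.inn_rel_iff[OF quandle_pullback[OF T Y(5)]]
      by (auto simp: pullback_carrier)
    ultimately have "x = y" by (rule split_byD[OF Y(5)])
    then show ?thesis using x y by simp
  qed
  then show ?thesis unfolding split_by_iff[OF f] using T by blast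
qed

end

theory Submission
  imports Defs
begin

text \<open>The central extensions are the coverings. If \<open>f x = f x'\<close>, then \<open>z \<triangleleft> x\<close> and \<open>z \<triangleleft> x'\<close> lie over the same
  point of \<open>E\<close> in one component of \<open>E \<times>\<^sub>B A\<close>, so a split \<open>f\<close> is a covering. Conversely a covering \<open>f\<close> is
  split by the quandle of pairs \<open>(a, g)\<close>, where \<open>g\<close> is an endomorphism of \<open>A\<close> that is surjective on
  fibres of \<open>f\<close>, mapped to \<open>B\<close> by \<open>(a, g) \<mapsto> f (g a)\<close>. Its operation
  \<open>(a, g) \<triangleleft> (b, h) = (a, \<rho>\<^bsub>h b\<^esub> \<circ> g \<circ> \<rho>\<^bsub>a\<^esub>\<inverse>)\<close>, with \<open>\<rho>\<close> the right translations, is modelled on Eisermann's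
  universal covering: the factor \<open>\<rho>\<^bsub>a\<^esub>\<inverse>\<close> makes it idempotent. A path carries \<open>((a, g), g y)\<close> with
  \<open>f y = f a\<close> to some \<open>((a, g'), g' y)\<close>, so \<open>g = g'\<close> forces the second coordinates to agree.

  The kernel of a map from \<open>f\<close> to a covering is therefore a congruence containing \<open>R\<close>, which gives the
  reflection. Transitivity of \<open>p\<^sub>2 (Eq p\<^sub>1 \<inter> \<sim>)\<close> holds because a weakly universal \<open>p\<close> splits itself, so
  that a loop at one point of a fibre of \<open>p\<close> is a loop at every point of it.\<close>

section \<open>Coverings, and why central extensions are coverings\<close>

definition covering :: "'a quandle \<Rightarrow> 'b quandle \<Rightarrow> ('a \<Rightarrow> 'b) \<Rightarrow> bool" where
  "covering A B f \<longleftrightarrow> extension A B f \<and> (\<forall>a\<in>carrier A. \<forall>a'\<in>carrier A. f a = f a' \<longrightarrow>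
     (\<forall>c\<in>carrier A. c \<triangleleft>\<^bsub>A\<^esub> a = c \<triangleleft>\<^bsub>A\<^esub> a'))"

lemma coveringD:
  assumes "covering A B f" "a \<in> carrier A" "a' \<in> carrier A" "f a = f a'" "c \<in> carrier A"
  shows "c \<triangleleft>\<^bsub>A\<^esub> a = c \<triangleleft>\<^bsub>A\<^esub> a'"
  using assms unfolding covering_def by blast

lemma covering_inv:
  assumes "covering A B f" "a \<in> carrier A" "a' \<in> carrier A" "f a = f a'" "c \<in> carrier A"
  shows "c \<triangleleft>\<inverse>\<^bsub>A\<^esub> a = c \<triangleleft>\<inverse>\<^bsub>A\<^esub> a'"
proof -
  interpret A: quandle A using assms(1) by (simp add: covering_def extension_def)
  have "(c \<triangleleft>\<inverse>\<^bsub>A\<^esub> a) \<triangleleft>\<^bsub>A\<^esub> a' = c"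
    using coveringD[OF assms(1-4), of "c \<triangleleft>\<inverse>\<^bsub>A\<^esub> a"] assms(2,5) by simp
  then show ?thesis using A.op_inv[of "c \<triangleleft>\<inverse>\<^bsub>A\<^esub> a" a'] assms by simp
qed

lemma (in quandle) inv_idem: "a \<in> carrier Q \<Longrightarrow> a \<triangleleft>\<inverse> a = a"
  using op_inv[of a a] idem[of a] by simp

text \<open>Checked after applying \<open>\<triangleleft> c\<close>, which is injective and respects
  both operations. Together with \<open>distrib_inv\<close> this makes inverse right translations
  endomorphisms too, as \<open>fibre_endos_translate\<close> requires.\<close>

lemma (in quandle) inv_distrib_inv:
  assumes "a \<in> carrier Q" "b \<in> carrier Q" "c \<in> carrier Q"
  shows "(a \<triangleleft>\<inverse> b) \<triangleleft>\<inverse> c = (a \<triangleleft>\<inverse> c) \<triangleleft>\<inverse> (b \<triangleleft>\<inverse> c)"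
proof -
  have "((a \<triangleleft>\<inverse> c) \<triangleleft>\<inverse> (b \<triangleleft>\<inverse> c)) \<triangleleft> c = a \<triangleleft>\<inverse> b"
    using inv_distrib[of "a \<triangleleft>\<inverse> c" "b \<triangleleft>\<inverse> c" c] assms by simp
  then show ?thesis using op_inv[of "(a \<triangleleft>\<inverse> c) \<triangleleft>\<inverse> (b \<triangleleft>\<inverse> c)" c] assms by simp
qed

lemma (in quandle) distrib_inv:
  assumes "a \<in> carrier Q" "b \<in> carrier Q" "c \<in> carrier Q"
  shows "(a \<triangleleft> b) \<triangleleft>\<inverse> c = (a \<triangleleft>\<inverse> c) \<triangleleft> (b \<triangleleft>\<inverse> c)"
proof -
  have "((a \<triangleleft>\<inverse> c) \<triangleleft> (b \<triangleleft>\<inverse> c)) \<triangleleft> c = a \<triangleleft> b"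
    using distrib[of "a \<triangleleft>\<inverse> c" "b \<triangleleft>\<inverse> c" c] assms by simp
  then show ?thesis using op_inv[of "(a \<triangleleft>\<inverse> c) \<triangleleft> (b \<triangleleft>\<inverse> c)" c] assms by simp
qed

lemma (in quandle) inn_rel_op:
  assumes "a \<in> carrier Q" "b \<in> carrier Q"
  shows "(a, a \<triangleleft> b) \<in> inn_rel Q" "(a, a \<triangleleft>\<inverse> b) \<in> inn_rel Q"
  using assms by (auto simp: inn_rel_iff step_def intro!: r_into_rtrancl)

lemma (in quandle) inn_rel_sym: "(a, b) \<in> inn_rel Q \<Longrightarrow> (b, a) \<in> inn_rel Q"
  using equiv_inn_rel by (auto elim: equivE symE)

lemma (in quandle) inn_rel_trans: "(a, b) \<in> inn_rel Q \<Longrightarrow> (b, c) \<in> inn_rel Q \<Longrightarrow> (a, c) \<in> inn_rel Q"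
  using equiv_inn_rel by (auto elim: equivE transE)

text \<open>Choose \<open>e\<close> and \<open>d\<close> over \<open>f z\<close> and
  \<open>f x\<close>. Acting on \<open>(e, z)\<close> by \<open>(d, x)\<close> and by
  \<open>(d, x')\<close> gives two points of one orbit that share the first coordinate
  \<open>e \<triangleleft> d\<close>. For a split \<open>f\<close> this yields the covering
  condition; for a weakly universal \<open>p\<close> it puts the generators of
  \<open>covering_cong\<close> into the fibre relation.\<close>

lemma pullback_inn_rel_covering:
  assumes E: "extension E B p" and A: "extension A B f"
    and z: "z \<in> carrier A" and x: "x \<in> carrier A" "x' \<in> carrier A" "f x = f x'"
  shows "\<exists>e. ((e, z \<triangleleft>\<^bsub>A\<^esub> x), (e, z \<triangleleft>\<^bsub>A\<^esub> x')) \<in> inn_rel (pullback E p A f)"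
proof -
  interpret P: quandle "pullback E p A f" by (rule quandle_pullback[OF E A])
  have fB: "f z \<in> p ` carrier E" "f x \<in> p ` carrier E"
    using extensionD(4)[OF E] quandle_homD(1)[OF extensionD(3)[OF A]] z x by auto
  then obtain e d where ed: "e \<in> carrier E" "p e = f z" "d \<in> carrier E" "p d = f x" by (metis imageE)
  have c: "(e, z) \<in> carrier (pullback E p A f)" "(d, x) \<in> carrier (pullback E p A f)"
    "(d, x') \<in> carrier (pullback E p A f)"
    using ed z x by (auto simp: pullback_carrier)
  show ?thesis
    using P.inn_rel_trans[OF P.inn_rel_sym[OF P.inn_rel_op(1)[OF c(1,2)]] P.inn_rel_op(1)[OF c(1,3)]]
    by (auto simp: pullback_ops)
qed

lemma central_imp_covering:
  assumes "central_extension A B f"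
  shows "covering A B f"
proof -
  have A: "extension A B f" using assms by (simp add: central_extension_def)
  obtain E :: "('b + nat) qterm quandle" and p where s: "split_by B E p A f"
    using assms by (auto simp: central_extension_def)
  have E: "extension E B p" using s by (simp add: split_by_def)
  have "c \<triangleleft>\<^bsub>A\<^esub> a = c \<triangleleft>\<^bsub>A\<^esub> a'"
    if "c \<in> carrier A" "a \<in> carrier A" "a' \<in> carrier A" "f a = f a'" for a a' c
    using pullback_inn_rel_covering[OF E A that] by (elim exE) (rule split_byD[OF A s])
  then show ?thesis unfolding covering_def using A by blast
qed

section \<open>The quandle of pairs that splits a given covering\<close>

definition fibre_endos :: "'a quandle \<Rightarrow> ('a \<Rightarrow> 'b) \<Rightarrow> ('a \<Rightarrow> 'a) set" where
  "fibre_endos A f = {g \<in> quandle_hom A A \<inter> extensional (carrier A).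
     \<forall>u\<in>carrier A. \<forall>z\<in>carrier A. f z = f (g u) \<longrightarrow> (\<exists>y\<in>carrier A. f y = f u \<and> g y = z)}"

definition endo_quandle :: "'a quandle \<Rightarrow> ('a \<Rightarrow> 'b) \<Rightarrow> ('a \<times> ('a \<Rightarrow> 'a)) quandle" where
  "endo_quandle A f = \<lparr>carrier = carrier A \<times> fibre_endos A f,
     qop = (\<lambda>(a, g) (b, h). (a, \<lambda>x\<in>carrier A. g (x \<triangleleft>\<inverse>\<^bsub>A\<^esub> a) \<triangleleft>\<^bsub>A\<^esub> h b)),
     qinv = (\<lambda>(a, g) (b, h). (a, \<lambda>x\<in>carrier A. g (x \<triangleleft>\<^bsub>A\<^esub> a) \<triangleleft>\<inverse>\<^bsub>A\<^esub> h b))\<rparr>"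

lemma endo_quandle_simps:
  "carrier (endo_quandle A f) = carrier A \<times> fibre_endos A f"
  "(a, g) \<triangleleft>\<^bsub>endo_quandle A f\<^esub> (b, h) = (a, \<lambda>x\<in>carrier A. g (x \<triangleleft>\<inverse>\<^bsub>A\<^esub> a) \<triangleleft>\<^bsub>A\<^esub> h b)"
  "(a, g) \<triangleleft>\<inverse>\<^bsub>endo_quandle A f\<^esub> (b, h) = (a, \<lambda>x\<in>carrier A. g (x \<triangleleft>\<^bsub>A\<^esub> a) \<triangleleft>\<inverse>\<^bsub>A\<^esub> h b)"
  by (simp_all add: endo_quandle_def)

lemma fibre_endosD:
  assumes "g \<in> fibre_endos A f" "x \<in> carrier A"
  shows "g x \<in> carrier A"
    and "y \<in> carrier A \<Longrightarrow> g (x \<triangleleft>\<^bsub>A\<^esub> y) = g x \<triangleleft>\<^bsub>A\<^esub> g y"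
    and "y \<in> carrier A \<Longrightarrow> g (x \<triangleleft>\<inverse>\<^bsub>A\<^esub> y) = g x \<triangleleft>\<inverse>\<^bsub>A\<^esub> g y"
  using assms quandle_homD[of g A A x] by (auto simp: fibre_endos_def)

lemma fibre_endos_extensional: "g \<in> fibre_endos A f \<Longrightarrow> g \<in> extensional (carrier A)"
  by (simp add: fibre_endos_def)

text \<open>At \<open>u = a\<close> this writes any point over \<open>f (g a)\<close> as
  \<open>g y\<close> with \<open>f y = f a\<close>. So every point of the pullback over
  \<open>(a, g)\<close> has the form required by \<open>endo_quandle_path\<close>.\<close>

lemma fibre_endos_fibre:
  assumes "g \<in> fibre_endos A f" "u \<in> carrier A" "z \<in> carrier A" "f z = f (g u)"
  shows "\<exists>y\<in>carrier A. f y = f u \<and> g y = z"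
  using assms by (auto simp: fibre_endos_def)

lemma fibre_endos_translate:
  assumes A: "extension A B f" and g: "g \<in> fibre_endos A f" and a: "a \<in> carrier A" and c: "c \<in> carrier A"
  shows "(\<lambda>x\<in>carrier A. g (x \<triangleleft>\<inverse>\<^bsub>A\<^esub> a) \<triangleleft>\<^bsub>A\<^esub> c) \<in> fibre_endos A f" (is "?g \<in> _")
    and "(\<lambda>x\<in>carrier A. g (x \<triangleleft>\<^bsub>A\<^esub> a) \<triangleleft>\<inverse>\<^bsub>A\<^esub> c) \<in> fibre_endos A f" (is "?h \<in> _")
proof -
  interpret A: quandle A by (rule extensionD(1)[OF A])
  interpret B: quandle B by (rule extensionD(2)[OF A])
  note gD [simp] = fibre_endosD[OF g] and fD [simp] = quandle_homD[OF extensionD(3)[OF A]]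
  \<comment> \<open>Once \<open>g\<close> is distributed over the operations, \<open>?g\<close> and
    \<open>?h\<close> are translates of \<open>g x\<close> by \<open>g a\<close> and
    \<open>c\<close>. The four identities say that \<open>x \<mapsto> (x \<triangleleft>\<inverse>
    z) \<triangleleft> c\<close> and \<open>x \<mapsto> (x \<triangleleft> z)
    \<triangleleft>\<inverse> c\<close> preserve both operations; they are used at
    \<open>z = g a\<close>.\<close>
  have tr: "((x \<triangleleft>\<^bsub>A\<^esub> y) \<triangleleft>\<inverse>\<^bsub>A\<^esub> z) \<triangleleft>\<^bsub>A\<^esub> c = ((x \<triangleleft>\<inverse>\<^bsub>A\<^esub> z) \<triangleleft>\<^bsub>A\<^esub> c) \<triangleleft>\<^bsub>A\<^esub> ((y \<triangleleft>\<inverse>\<^bsub>A\<^esub> z) \<triangleleft>\<^bsub>A\<^esub> c)"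
    "((x \<triangleleft>\<inverse>\<^bsub>A\<^esub> y) \<triangleleft>\<inverse>\<^bsub>A\<^esub> z) \<triangleleft>\<^bsub>A\<^esub> c = ((x \<triangleleft>\<inverse>\<^bsub>A\<^esub> z) \<triangleleft>\<^bsub>A\<^esub> c) \<triangleleft>\<inverse>\<^bsub>A\<^esub> ((y \<triangleleft>\<inverse>\<^bsub>A\<^esub> z) \<triangleleft>\<^bsub>A\<^esub> c)"
    "((x \<triangleleft>\<^bsub>A\<^esub> y) \<triangleleft>\<^bsub>A\<^esub> z) \<triangleleft>\<inverse>\<^bsub>A\<^esub> c = ((x \<triangleleft>\<^bsub>A\<^esub> z) \<triangleleft>\<inverse>\<^bsub>A\<^esub> c) \<triangleleft>\<^bsub>A\<^esub> ((y \<triangleleft>\<^bsub>A\<^esub> z) \<triangleleft>\<inverse>\<^bsub>A\<^esub> c)"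
    "((x \<triangleleft>\<inverse>\<^bsub>A\<^esub> y) \<triangleleft>\<^bsub>A\<^esub> z) \<triangleleft>\<inverse>\<^bsub>A\<^esub> c = ((x \<triangleleft>\<^bsub>A\<^esub> z) \<triangleleft>\<inverse>\<^bsub>A\<^esub> c) \<triangleleft>\<inverse>\<^bsub>A\<^esub> ((y \<triangleleft>\<^bsub>A\<^esub> z) \<triangleleft>\<inverse>\<^bsub>A\<^esub> c)"
    if "x \<in> carrier A" "y \<in> carrier A" "z \<in> carrier A" for x y z
    using that c A.distrib_inv[of x y z] A.distrib[of "x \<triangleleft>\<inverse>\<^bsub>A\<^esub> z" "y \<triangleleft>\<inverse>\<^bsub>A\<^esub> z" c]
      A.inv_distrib_inv[of x y z] A.inv_distrib[of "x \<triangleleft>\<inverse>\<^bsub>A\<^esub> z" "y \<triangleleft>\<inverse>\<^bsub>A\<^esub> z" c]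
      A.distrib[of x y z] A.distrib_inv[of "x \<triangleleft>\<^bsub>A\<^esub> z" "y \<triangleleft>\<^bsub>A\<^esub> z" c]
      A.inv_distrib[of x y z] A.inv_distrib_inv[of "x \<triangleleft>\<^bsub>A\<^esub> z" "y \<triangleleft>\<^bsub>A\<^esub> z" c]
    by (simp_all only: A.op_closed A.inv_closed)
  have gh: "?g \<in> quandle_hom A A" "?h \<in> quandle_hom A A"
    using a c by (auto simp: quandle_hom_def tr)
  have fib: "\<exists>y\<in>carrier A. f y = f u \<and> ?g y = z"
    if u: "u \<in> carrier A" and z: "z \<in> carrier A" and eq: "f z = f (?g u)" for u z
  proof -
    \<comment> \<open>To solve \<open>?g v = z\<close> with \<open>v\<close> in the fibre of
      \<open>u\<close>: undo the translation by \<open>c\<close>, solve for \<open>g\<close> in the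
      fibre of \<open>u \<triangleleft>\<inverse> a\<close>, and translate the solution back by
      \<open>a\<close>.\<close>
    have "f (z \<triangleleft>\<inverse>\<^bsub>A\<^esub> c) = f (g (u \<triangleleft>\<inverse>\<^bsub>A\<^esub> a))" using eq u z a c by (simp del: gD(3))
    then obtain y where "y \<in> carrier A" "f y = f (u \<triangleleft>\<inverse>\<^bsub>A\<^esub> a)" "g y = z \<triangleleft>\<inverse>\<^bsub>A\<^esub> c"
      using fibre_endos_fibre[OF g, of "u \<triangleleft>\<inverse>\<^bsub>A\<^esub> a" "z \<triangleleft>\<inverse>\<^bsub>A\<^esub> c"] u z a c by auto
    then show ?thesis using u z a c
      by (intro bexI[of _ "y \<triangleleft>\<^bsub>A\<^esub> a"]) (simp_all del: gD)
  qed
  have fib': "\<exists>y\<in>carrier A. f y = f u \<and> ?h y = z"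
    if u: "u \<in> carrier A" and z: "z \<in> carrier A" and eq: "f z = f (?h u)" for u z
  proof -
    have "f (z \<triangleleft>\<^bsub>A\<^esub> c) = f (g (u \<triangleleft>\<^bsub>A\<^esub> a))" using eq u z a c by (simp del: gD(2))
    then obtain y where "y \<in> carrier A" "f y = f (u \<triangleleft>\<^bsub>A\<^esub> a)" "g y = z \<triangleleft>\<^bsub>A\<^esub> c"
      using fibre_endos_fibre[OF g, of "u \<triangleleft>\<^bsub>A\<^esub> a" "z \<triangleleft>\<^bsub>A\<^esub> c"] u z a c by auto
    then show ?thesis using u z a c
      by (intro bexI[of _ "y \<triangleleft>\<inverse>\<^bsub>A\<^esub> a"]) (simp_all del: gD)
  qed
  show "?g \<in> fibre_endos A f" using gh(1) fib by (auto simp: fibre_endos_def)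
  show "?h \<in> fibre_endos A f" using gh(2) fib' by (auto simp: fibre_endos_def)
qed

text \<open>A pair \<open>(b, h)\<close> acts only through the value \<open>h b\<close>. Under the
  action of \<open>(c, k)\<close> this value becomes \<open>h b \<triangleleft> k c\<close>, because
  \<open>b \<triangleleft>\<inverse> b = b\<close>, so self-distributivity reduces to that of
  \<open>A\<close>. Idempotence holds because \<open>g\<close> is a homomorphism:
  \<open>g (x \<triangleleft>\<inverse> a) \<triangleleft> g a = g x\<close>.\<close>

lemma quandle_endo_quandle:
  assumes A: "extension A B f"
  shows "quandle (endo_quandle A f)"
proof -
  interpret A: quandle A by (rule extensionD(1)[OF A])
  note tr = fibre_endos_translate[OF A]
  note D = fibre_endosD(1)
  \<comment> \<open>The axioms are verified pointwise on \<open>carrier A\<close>; extensionality of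
    the members of \<open>fibre_endos\<close> turns this into equality of functions.\<close>
  have restr: "(\<lambda>x\<in>carrier A. k x) = g" if "g \<in> fibre_endos A f" "\<And>x. x \<in> carrier A \<Longrightarrow> k x = g x" for k g
    using that fibre_endos_extensional[OF that(1)] by (auto simp: extensional_def restrict_def)
  show ?thesis
  proof
    fix u v assume "u \<in> carrier (endo_quandle A f)" "v \<in> carrier (endo_quandle A f)"
    then obtain a g b h where [simp]: "u = (a, g)" "v = (b, h)"
      and uv: "a \<in> carrier A" "g \<in> fibre_endos A f" "b \<in> carrier A" "h \<in> fibre_endos A f"
      by (auto simp: endo_quandle_simps)
    show "u \<triangleleft>\<^bsub>endo_quandle A f\<^esub> v \<in> carrier (endo_quandle A f)"
      "u \<triangleleft>\<inverse>\<^bsub>endo_quandle A f\<^esub> v \<in> carrier (endo_quandle A f)"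
      using uv tr[OF uv(2,1) D[OF uv(4,3)]] by (simp_all add: endo_quandle_simps)
    show "(u \<triangleleft>\<^bsub>endo_quandle A f\<^esub> v) \<triangleleft>\<inverse>\<^bsub>endo_quandle A f\<^esub> v = u"
      "(u \<triangleleft>\<inverse>\<^bsub>endo_quandle A f\<^esub> v) \<triangleleft>\<^bsub>endo_quandle A f\<^esub> v = u"
      using uv by (auto simp: endo_quandle_simps D intro!: restr)
  next
    fix u assume "u \<in> carrier (endo_quandle A f)"
    then show "u \<triangleleft>\<^bsub>endo_quandle A f\<^esub> u = u"
      by (auto simp: endo_quandle_simps fibre_endosD intro!: restr)
  next
    fix u v w assume "u \<in> carrier (endo_quandle A f)" "v \<in> carrier (endo_quandle A f)"
      "w \<in> carrier (endo_quandle A f)"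
    then obtain a g b h c k where [simp]: "u = (a, g)" "v = (b, h)" "w = (c, k)"
      and uvw: "a \<in> carrier A" "g \<in> fibre_endos A f" "b \<in> carrier A" "h \<in> fibre_endos A f"
        "c \<in> carrier A" "k \<in> fibre_endos A f"
      by (auto simp: endo_quandle_simps)
    show "(u \<triangleleft>\<^bsub>endo_quandle A f\<^esub> v) \<triangleleft>\<^bsub>endo_quandle A f\<^esub> w =
      (u \<triangleleft>\<^bsub>endo_quandle A f\<^esub> w) \<triangleleft>\<^bsub>endo_quandle A f\<^esub> (v \<triangleleft>\<^bsub>endo_quandle A f\<^esub> w)"
      using uvw by (auto simp: endo_quandle_simps D A.inv_idem intro!: restrict_ext A.distrib)
  qed
qed

text \<open>Since \<open>a \<triangleleft>\<inverse> a = a\<close>, the endomorphism produced by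
  acting with \<open>(b, h)\<close> sends \<open>a\<close> to
  \<open>g a \<triangleleft> h b\<close>, so the projection is a homomorphism. The identity paired
  with arbitrary \<open>a\<close> already gives surjectivity.\<close>

lemma extension_endo_quandle:
  assumes A: "extension A B f"
  shows "extension (endo_quandle A f) B (\<lambda>(a, g). f (g a))"
proof -
  interpret A: quandle A by (rule extensionD(1)[OF A])
  note fD = quandle_homD[OF extensionD(3)[OF A]]
  have "(\<lambda>(a, g). f (g a)) \<in> quandle_hom (endo_quandle A f) B"
    by (auto simp: quandle_hom_def endo_quandle_simps A.idem A.inv_idem fD fibre_endosD(1))
  moreover have "carrier B \<subseteq> (\<lambda>(a, g). f (g a)) ` carrier (endo_quandle A f)"
  proof
    fix b assume "b \<in> carrier B"
    then obtain a where a: "a \<in> carrier A" "f a = b" using extensionD(4)[OF A] by (metis imageE)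
    have "(\<lambda>x\<in>carrier A. x) \<in> fibre_endos A f" by (auto simp: fibre_endos_def quandle_hom_def)
    then show "b \<in> (\<lambda>(a, g). f (g a)) ` carrier (endo_quandle A f)"
      using a by (intro image_eqI[of _ _ "(a, \<lambda>x\<in>carrier A. x)"]) (simp_all add: endo_quandle_simps)
  qed
  moreover have "(\<lambda>(a, g). f (g a)) ` carrier (endo_quandle A f) \<subseteq> carrier B"
    using quandle_homD(1)[OF calculation(1)] by blast
  ultimately show ?thesis
    unfolding extension_def using quandle_endo_quandle[OF A] extensionD(2)[OF A] by blast
qed

text \<open>The covering condition enters twice. It gives
  \<open>y \<triangleleft> a = y \<triangleleft> y = y\<close>, so the inner translation by
  \<open>a\<close> does not move \<open>y\<close>; and acting by \<open>x\<close> agrees with acting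
  by \<open>h b\<close>, because \<open>f (h b) = f x\<close>. Hence evaluation at \<open>y\<close>
  relates the two coordinates after each step as before it.\<close>

lemma endo_quandle_path:
  assumes A: "covering A B f"
    and path: "(u, v) \<in> (step (pullback (endo_quandle A f) (\<lambda>(a, g). f (g a)) A f))\<^sup>*"
    and u: "u = ((a, g), g y)" "y \<in> carrier A" "f y = f a" "a \<in> carrier A"
  shows "\<exists>g'. v = ((a, g'), g' y)"
  using path
proof (induction rule: rtrancl_induct)
  case base
  then show ?case using u by auto
next
  case (step v w)
  have ext: "extension A B f" using A by (simp add: covering_def)
  interpret A: quandle A by (rule extensionD(1)[OF ext])
  obtain g' where v: "v = ((a, g'), g' y)" using step.IH by blast
  obtain b h x where bhx: "b \<in> carrier A" "h \<in> fibre_endos A f" "x \<in> carrier A" "f (h b) = f x"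
    and w: "w = ((a, \<lambda>x\<in>carrier A. g' (x \<triangleleft>\<inverse>\<^bsub>A\<^esub> a) \<triangleleft>\<^bsub>A\<^esub> h b), g' y \<triangleleft>\<^bsub>A\<^esub> x) \<or>
      w = ((a, \<lambda>x\<in>carrier A. g' (x \<triangleleft>\<^bsub>A\<^esub> a) \<triangleleft>\<inverse>\<^bsub>A\<^esub> h b), g' y \<triangleleft>\<inverse>\<^bsub>A\<^esub> x)"
    and g': "g' \<in> fibre_endos A f"
    using step.hyps(2) by (auto simp: step_def v pullback_carrier pullback_ops endo_quandle_simps)
  have hb: "h b \<in> carrier A" by (rule fibre_endosD(1)[OF bhx(2,1)])
  have gy: "g' y \<in> carrier A" by (rule fibre_endosD(1)[OF g' u(2)])
  have fix_y: "y \<triangleleft>\<^bsub>A\<^esub> a = y" "y \<triangleleft>\<inverse>\<^bsub>A\<^esub> a = y"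
    using coveringD[OF A u(2,4,3,2)] covering_inv[OF A u(2,4,3,2)] A.idem A.inv_idem u(2) by auto
  note eq = coveringD[OF A hb bhx(3,4) gy] covering_inv[OF A hb bhx(3,4) gy]
  let ?g\<^sub>1 = "\<lambda>x\<in>carrier A. g' (x \<triangleleft>\<inverse>\<^bsub>A\<^esub> a) \<triangleleft>\<^bsub>A\<^esub> h b"
    and ?g\<^sub>2 = "\<lambda>x\<in>carrier A. g' (x \<triangleleft>\<^bsub>A\<^esub> a) \<triangleleft>\<inverse>\<^bsub>A\<^esub> h b"
  have "?g\<^sub>1 y = g' y \<triangleleft>\<^bsub>A\<^esub> x" "?g\<^sub>2 y = g' y \<triangleleft>\<inverse>\<^bsub>A\<^esub> x"
    using u(2) eq by (simp_all only: restrict_apply' fix_y)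
  then have "w = ((a, ?g\<^sub>1), ?g\<^sub>1 y) \<or> w = ((a, ?g\<^sub>2), ?g\<^sub>2 y)" using w by (simp only:)
  then show ?case by blast
qed

lemma covering_split_by_endo_quandle:
  assumes A: "covering A B f"
  shows "split_by B (endo_quandle A f) (\<lambda>(a, g). f (g a)) A f"
proof -
  have ext: "extension A B f" using A by (simp add: covering_def)
  note E = extension_endo_quandle[OF ext]
  let ?P = "pullback (endo_quandle A f) (\<lambda>(a, g). f (g a)) A f"
  have "x = x'" if r: "((e, x), (e, x')) \<in> inn_rel ?P" for e x x'
  proof -
    obtain a g where e: "e = (a, g)" by (cases e)
    have c: "a \<in> carrier A" "g \<in> fibre_endos A f" "x \<in> carrier A" "f x = f (g a)"
      using r by (auto simp: inn_rel_def pullback_carrier endo_quandle_simps e)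
    obtain y where y: "y \<in> carrier A" "f y = f a" "g y = x" using fibre_endos_fibre[OF c(2,1,3,4)] by blast
    have "((e, x), (e, x')) \<in> (step ?P)\<^sup>*"
      using r quandle.inn_rel_iff[OF quandle_pullback[OF E ext]] by blast
    \<comment> \<open>The path ends at first coordinate \<open>(a, g)\<close> again, so the
      endomorphism supplied is \<open>g\<close> itself and \<open>x' = g y = x\<close>.\<close>
    from endo_quandle_path[OF A this _ y(1,2) c(1)] show ?thesis using e y by auto
  qed
  then show ?thesis unfolding split_by_iff[OF ext] using E by blast
qed

text \<open>The splitting quandle lives on pairs over the type of \<open>A\<close>, not on the terms
  that the definition of \<open>central_extension\<close> quantifies over;
  \<open>central_extensionI\<close> bridges the two.\<close>

theorem central_extension_iff_covering: "central_extension A B f \<longleftrightarrow> covering A B f"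
proof
  assume "covering A B f"
  then show "central_extension A B f"
    by (intro central_extensionI[OF _ covering_split_by_endo_quandle]) (simp add: covering_def)
qed (rule central_imp_covering)

section \<open>Congruences, quotients and induced maps\<close>

lemma congruenceD:
  assumes "congruence A S"
  shows "equiv (carrier A) S"
    and "\<lbrakk>(a, a') \<in> S; (b, b') \<in> S\<rbrakk> \<Longrightarrow> (a \<triangleleft>\<^bsub>A\<^esub> b, a' \<triangleleft>\<^bsub>A\<^esub> b') \<in> S"
    and "\<lbrakk>(a, a') \<in> S; (b, b') \<in> S\<rbrakk> \<Longrightarrow> (a \<triangleleft>\<inverse>\<^bsub>A\<^esub> b, a' \<triangleleft>\<inverse>\<^bsub>A\<^esub> b') \<in> S"
  using assms by (force simp: congruence_def subquandle_def prod_quandle_def)+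

lemma congruenceI:
  assumes "equiv (carrier A) S"
    and "\<And>a a' b b'. \<lbrakk>(a, a') \<in> S; (b, b') \<in> S\<rbrakk> \<Longrightarrow> (a \<triangleleft>\<^bsub>A\<^esub> b, a' \<triangleleft>\<^bsub>A\<^esub> b') \<in> S"
    and "\<And>a a' b b'. \<lbrakk>(a, a') \<in> S; (b, b') \<in> S\<rbrakk> \<Longrightarrow> (a \<triangleleft>\<inverse>\<^bsub>A\<^esub> b, a' \<triangleleft>\<inverse>\<^bsub>A\<^esub> b') \<in> S"
  shows "congruence A S"
  using assms equiv_type[OF assms(1)]
  by (auto simp: congruence_def subquandle_def prod_quandle_def)

lemma equiv_Eq: "equiv (carrier A) (Eq A f)"
  by (rule equivI) (auto simp: Eq_def refl_on_def sym_def trans_def)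

lemma congruence_Eq:
  assumes "quandle A" "f \<in> quandle_hom A B"
  shows "congruence A (Eq A f)"
proof -
  interpret quandle A by fact
  show ?thesis by (rule congruenceI[OF equiv_Eq]) (auto simp: Eq_def quandle_homD[OF assms(2)])
qed

lemma congruence_generated_least:
  "\<lbrakk>congruence A S; R \<subseteq> S\<rbrakk> \<Longrightarrow> congruence_generated A R \<subseteq> S"
  by (auto simp: congruence_generated_def)

lemma congruence_generated_incl: "R \<subseteq> congruence_generated A R"
  by (auto simp: congruence_generated_def)

text \<open>Bounds the intersection in \<open>congruence_generated\<close>: the family always has
  this member when \<open>R\<close> lies in \<open>carrier A \<times> carrier A\<close>.\<close>

lemma congruence_full:
  assumes "quandle A"
  shows "congruence A (carrier A \<times> carrier A)"
proof -
  interpret quandle A by fact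
  show ?thesis by (rule congruenceI) (auto intro!: equivI simp: refl_on_def sym_def trans_def)
qed

lemma congruence_congruence_generated:
  assumes A: "quandle A" and R: "R \<subseteq> carrier A \<times> carrier A"
  shows "congruence A (congruence_generated A R)"
proof (rule congruenceI)
  let ?C = "congruence_generated A R"
  have mem: "x \<in> ?C \<longleftrightarrow> (\<forall>S. congruence A S \<and> R \<subseteq> S \<longrightarrow> x \<in> S)" for x
    by (auto simp: congruence_generated_def)
  note D = congruenceD(1)
  show "equiv (carrier A) ?C"
  proof (rule equivI)
    show "?C \<subseteq> carrier A \<times> carrier A" by (rule congruence_generated_least[OF congruence_full[OF A] R])
    show "refl_on (carrier A) ?C"
      using D by (fastforce simp: refl_on_def mem elim!: equivE)
    show "sym ?C"
      unfolding sym_def mem using D by (meson equivE symE)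
    show "trans ?C"
      unfolding trans_def mem using D by (meson equivE transE)
  qed
  show "(a \<triangleleft>\<^bsub>A\<^esub> b, a' \<triangleleft>\<^bsub>A\<^esub> b') \<in> ?C" "(a \<triangleleft>\<inverse>\<^bsub>A\<^esub> b, a' \<triangleleft>\<inverse>\<^bsub>A\<^esub> b') \<in> ?C"
    if "(a, a') \<in> ?C" "(b, b') \<in> ?C" for a a' b b'
    using that congruenceD(2,3) unfolding mem by metis+
qed

lemma quotient_map_eq_iff:
  assumes "congruence A S" "a \<in> carrier A" "a' \<in> carrier A"
  shows "quotient_map S a = quotient_map S a' \<longleftrightarrow> (a, a') \<in> S"
  unfolding quotient_map_def by (rule eq_equiv_class_iff[OF congruenceD(1)[OF assms(1)] assms(2,3)])

lemma quotient_carrier: "carrier (quotient_quandle A S) = quotient_map S ` carrier A"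
  by (auto simp: quotient_quandle_def quotient_def quotient_map_def)

lemma quotient_ops:
  assumes A: "quandle A" and S: "congruence A S" and ab: "a \<in> carrier A" "b \<in> carrier A"
  shows "quotient_map S a \<triangleleft>\<^bsub>quotient_quandle A S\<^esub> quotient_map S b = quotient_map S (a \<triangleleft>\<^bsub>A\<^esub> b)"
    and "quotient_map S a \<triangleleft>\<inverse>\<^bsub>quotient_quandle A S\<^esub> quotient_map S b = quotient_map S (a \<triangleleft>\<inverse>\<^bsub>A\<^esub> b)"
proof -
  interpret quandle A by fact
  have eq: "equiv (carrier A) S" by (rule congruenceD(1)[OF S])
  have refl: "(a, a) \<in> S" "(b, b) \<in> S" using eq ab by (auto elim!: equivE simp: refl_on_def)
  \<comment> \<open>All sets in the double union of \<open>quotient_quandle\<close> are therefore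
    one and the same class, and \<open>refl\<close> makes the index classes nonempty.\<close>
  have "S `` {x \<triangleleft>\<^bsub>A\<^esub> y} = S `` {a \<triangleleft>\<^bsub>A\<^esub> b}" "S `` {x \<triangleleft>\<inverse>\<^bsub>A\<^esub> y} = S `` {a \<triangleleft>\<inverse>\<^bsub>A\<^esub> b}"
    if "(a, x) \<in> S" "(b, y) \<in> S" for x y
    using congruenceD(2,3)[OF S that] equiv_class_eq[OF eq] by metis+
  then have "(\<Union>x\<in>S `` {a}. \<Union>y\<in>S `` {b}. S `` {x \<triangleleft>\<^bsub>A\<^esub> y}) = S `` {a \<triangleleft>\<^bsub>A\<^esub> b}"
    "(\<Union>x\<in>S `` {a}. \<Union>y\<in>S `` {b}. S `` {x \<triangleleft>\<inverse>\<^bsub>A\<^esub> y}) = S `` {a \<triangleleft>\<inverse>\<^bsub>A\<^esub> b}"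
    using refl by blast+
  then show "quotient_map S a \<triangleleft>\<^bsub>quotient_quandle A S\<^esub> quotient_map S b = quotient_map S (a \<triangleleft>\<^bsub>A\<^esub> b)"
    "quotient_map S a \<triangleleft>\<inverse>\<^bsub>quotient_quandle A S\<^esub> quotient_map S b = quotient_map S (a \<triangleleft>\<inverse>\<^bsub>A\<^esub> b)"
    by (simp_all add: quotient_quandle_def quotient_map_def)
qed

lemma quandle_quotient:
  assumes A: "quandle A" and S: "congruence A S"
  shows "quandle (quotient_quandle A S)"
proof -
  interpret A: quandle A by fact
  show ?thesis
    by unfold_locales (auto simp: quotient_carrier quotient_ops[OF A S] A.idem A.distrib[symmetric])
qed

lemma quotient_map_hom:
  assumes "quandle A" "congruence A S"
  shows "quotient_map S \<in> quandle_hom A (quotient_quandle A S)"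
  using quotient_ops[OF assms] by (auto simp: quandle_hom_def quotient_carrier)

lemma induced_map_quotient:
  assumes S: "congruence A S" "S \<subseteq> Eq A f" and a: "a \<in> carrier A"
  shows "induced_map f (quotient_map S a) = f a"
proof -
  have "f x = f a" if "(a, x) \<in> S" for x using that S(2) by (auto simp: Eq_def)
  moreover have "(a, a) \<in> S" using congruenceD(1)[OF S(1)] a by (auto elim!: equivE simp: refl_on_def)
  ultimately have "f ` quotient_map S a = {f a}" unfolding quotient_map_def by blast
  then show ?thesis by (simp add: induced_map_def)
qed

lemma induced_map_hom:
  assumes A: "quandle A" and S: "congruence A S" "S \<subseteq> Eq A f" and f: "f \<in> quandle_hom A B"
  shows "induced_map f \<in> quandle_hom (quotient_quandle A S) B"
proof -
  interpret A: quandle A by fact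
  show ?thesis
    using quandle_homD[OF f]
    by (auto simp: quandle_hom_def quotient_carrier quotient_ops[OF A S(1)] induced_map_quotient[OF S])
qed

section \<open>The reflection of an extension into coverings\<close>

lemma covering_rel_subset_Eq:
  assumes "covering A' B c'" "quandle A" "q \<in> quandle_hom A A'" "\<forall>a\<in>carrier A. c' (q a) = f a"
  shows "covering_rel A f \<subseteq> Eq A q"
proof -
  interpret A: quandle A by fact
  note q = quandle_homD[OF assms(3)]
  \<comment> \<open>\<open>q x\<close> and \<open>q x'\<close> lie in one fibre of
    \<open>c'\<close>, so they act alike on \<open>q z\<close>.\<close>
  show ?thesis
    using coveringD[OF assms(1)] assms(4) by (auto simp: covering_rel_def Eq_def q)
qed

context
  fixes A :: "'a quandle" and B :: "'b quandle" and f :: "'a \<Rightarrow> 'b"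
  assumes f: "extension A B f"
begin

interpretation A: quandle A by (rule extensionD(1)[OF f])

interpretation B: quandle B by (rule extensionD(2)[OF f])

lemma congruence_covering_cong: "congruence A (covering_cong A f)"
  unfolding covering_cong_def
  by (rule congruence_congruence_generated[OF extensionD(1)[OF f]]) (auto simp: covering_rel_def)

lemma covering_cong_subset_Eq: "covering_cong A f \<subseteq> Eq A f"
  unfolding covering_cong_def
  by (rule congruence_generated_least[OF congruence_Eq[OF extensionD(1,3)[OF f]]])
    (auto simp: covering_rel_def Eq_def quandle_homD[OF extensionD(3)[OF f]])

lemmas induced_map_class = induced_map_quotient[OF congruence_covering_cong covering_cong_subset_Eq]

text \<open>Classes in one fibre of the induced map have representatives \<open>x\<close>,
  \<open>x'\<close> with \<open>f x = f x'\<close>; then \<open>z \<triangleleft> x\<close> and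
  \<open>z \<triangleleft> x'\<close> form a generator, so the two classes act alike.\<close>

lemma covering_induced_map:
  "covering (quotient_quandle A (covering_cong A f)) B (induced_map f)"
proof -
  let ?S = "covering_cong A f" and ?Q = "quotient_quandle A (covering_cong A f)"
  note S = congruence_covering_cong
  have ext: "extension ?Q B (induced_map f)"
    using quandle_quotient[OF A.quandle_axioms S] B.quandle_axioms extensionD(4)[OF f]
      induced_map_hom[OF A.quandle_axioms S covering_cong_subset_Eq extensionD(3)[OF f]]
    by (auto simp: extension_def quotient_carrier image_image induced_map_class)
  have "(z \<triangleleft>\<^bsub>A\<^esub> x, z \<triangleleft>\<^bsub>A\<^esub> x') \<in> ?S"
    if "z \<in> carrier A" "x \<in> carrier A" "x' \<in> carrier A" "f x = f x'" for z x x'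
    using that congruence_generated_incl[of "covering_rel A f" A]
    unfolding covering_cong_def covering_rel_def by blast
  then show ?thesis
    using ext by (auto simp: covering_def quotient_carrier induced_map_class
        quotient_ops[OF A.quandle_axioms S] quotient_map_eq_iff[OF S])
qed

lemma reflection_exists_unique:
  assumes q: "q \<in> quandle_hom A A'" and c': "covering A' B c'" and fac: "\<forall>a\<in>carrier A. c' (q a) = f a"
  defines "Q \<equiv> quotient_quandle A (covering_cong A f)"
  shows "\<exists>!\<phi>. \<phi> \<in> extensional (carrier Q) \<and> \<phi> \<in> quandle_hom Q A'
     \<and> (\<forall>X\<in>carrier Q. c' (\<phi> X) = induced_map f X)
     \<and> (\<forall>a\<in>carrier A. \<phi> (quotient_map (covering_cong A f) a) = q a)"
proof -
  note S = congruence_covering_cong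
  have Sq: "covering_cong A f \<subseteq> Eq A q"
    unfolding covering_cong_def
    by (rule congruence_generated_least[OF congruence_Eq[OF A.quandle_axioms q]
          covering_rel_subset_Eq[OF c' A.quandle_axioms q fac]])
  interpret Q: quandle Q unfolding Q_def by (rule quandle_quotient[OF A.quandle_axioms S])
  have carQ: "carrier Q = quotient_map (covering_cong A f) ` carrier A"
    unfolding Q_def by (rule quotient_carrier)
  \<comment> \<open>Restricting to \<open>carrier Q\<close> fixes the values elsewhere, so that
    uniqueness is an equality of HOL functions.\<close>
  define \<phi> where "\<phi> = restrict (induced_map q) (carrier Q)"
  have \<phi>: "\<phi> (quotient_map (covering_cong A f) a) = q a" if "a \<in> carrier A" for a
    using that induced_map_quotient[OF S Sq that] by (simp add: \<phi>_def carQ)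
  have "induced_map q \<in> quandle_hom Q A'"
    unfolding Q_def by (rule induced_map_hom[OF A.quandle_axioms S Sq q])
  then have "\<phi> \<in> quandle_hom Q A'" by (auto simp: quandle_hom_def \<phi>_def)
  moreover have "\<forall>X\<in>carrier Q. c' (\<phi> X) = induced_map f X"
    using fac by (auto simp: carQ \<phi> induced_map_class)
  moreover have "\<phi> \<in> extensional (carrier Q)" by (simp add: \<phi>_def)
  moreover have "\<psi> = \<phi>" if "\<psi> \<in> extensional (carrier Q)"
    "\<forall>a\<in>carrier A. \<psi> (quotient_map (covering_cong A f) a) = q a" for \<psi>
    using that by (intro extensionalityI[OF that(1) \<open>\<phi> \<in> extensional (carrier Q)\<close>]) (auto simp: carQ \<phi>)
  ultimately show ?thesis using \<phi> by (intro ex1I[of _ \<phi>]) blast+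
qed

end

section \<open>The fibre relation of the pullback along a weakly universal extension\<close>

lemma pullback_path_transport:
  assumes p: "extension T B p" and f: "extension A B f"
    and path: "((t, a), v) \<in> (step (pullback T p A f))\<^sup>*"
    and s: "s \<in> carrier T" "p s = p t" "t \<in> carrier T" "a \<in> carrier A" "p t = f a"
  shows "\<exists>s'. ((t, s), (fst v, s')) \<in> (step (pullback T p T p))\<^sup>* \<and>
    ((s, a), (s', snd v)) \<in> (step (pullback T p A f))\<^sup>*"
  using path
proof (induction rule: rtrancl_induct)
  case base
  then show ?case by auto
next
  case (step v w)
  interpret P: quandle "pullback T p A f" by (rule quandle_pullback[OF p f])
  interpret R: quandle "pullback T p T p" by (rule quandle_pullback[OF p p])
  obtain s' where s': "((t, s), (fst v, s')) \<in> (step (pullback T p T p))\<^sup>*"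
    "((s, a), (s', snd v)) \<in> (step (pullback T p A f))\<^sup>*" using step.IH by blast
  obtain t' a' where v: "v = (t', a')" by (cases v)
  have c: "(t', s') \<in> carrier (pullback T p T p)" "(s', a') \<in> carrier (pullback T p A f)"
    using R.step_closed[OF s'(1)] P.step_closed[OF s'(2)] s by (auto simp: pullback_carrier v)
  obtain d b where db: "d \<in> carrier T" "b \<in> carrier A" "p d = f b"
    "w = (t' \<triangleleft>\<^bsub>T\<^esub> d, a' \<triangleleft>\<^bsub>A\<^esub> b) \<or> w = (t' \<triangleleft>\<inverse>\<^bsub>T\<^esub> d, a' \<triangleleft>\<inverse>\<^bsub>A\<^esub> b)"
    using step.hyps(2) by (auto simp: step_def pullback_carrier pullback_ops v)
  \<comment> \<open>The step by \<open>(d, b)\<close> is replayed from the other point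
    \<open>s\<close> of the fibre: by the diagonal element \<open>(d, d)\<close> on the pair of
    points of \<open>T\<close>, and by \<open>(d, b)\<close> itself on the second path.\<close>
  have db': "(d, d) \<in> carrier (pullback T p T p)" "(d, b) \<in> carrier (pullback T p A f)"
    using db by (auto simp: pullback_carrier)
  have st: "((t', s'), (t' \<triangleleft>\<^bsub>T\<^esub> d, s' \<triangleleft>\<^bsub>T\<^esub> d)) \<in> step (pullback T p T p)"
    "((t', s'), (t' \<triangleleft>\<inverse>\<^bsub>T\<^esub> d, s' \<triangleleft>\<inverse>\<^bsub>T\<^esub> d)) \<in> step (pullback T p T p)"
    "((s', a'), (s' \<triangleleft>\<^bsub>T\<^esub> d, a' \<triangleleft>\<^bsub>A\<^esub> b)) \<in> step (pullback T p A f)"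
    "((s', a'), (s' \<triangleleft>\<inverse>\<^bsub>T\<^esub> d, a' \<triangleleft>\<inverse>\<^bsub>A\<^esub> b)) \<in> step (pullback T p A f)"
    using c db' unfolding step_def
    by (force intro: bexI[of _ "(d, d)"] bexI[of _ "(d, b)"] simp: pullback_ops)+
  note s'' = s'[unfolded v fst_conv snd_conv]
  from db(4) show ?case
    using rtrancl_into_rtrancl[OF s''(1) st(1)] rtrancl_into_rtrancl[OF s''(2) st(3)]
      rtrancl_into_rtrancl[OF s''(1) st(2)] rtrancl_into_rtrancl[OF s''(2) st(4)]
    by auto
qed

text \<open>Replaying the path from \<open>s\<close> might end over another point \<open>s'\<close>.
  But the same steps carry \<open>(t, s)\<close> to \<open>(t, s')\<close> in the pullback of
  \<open>p\<close> along itself, and self-splitting forces \<open>s = s'\<close>.\<close>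

lemma self_split_inn_rel_fibre:
  assumes p: "extension T B p" and self: "split_by B T p T p" and f: "extension A B f"
    and r: "((t, a), (t, a')) \<in> inn_rel (pullback T p A f)"
    and s: "s \<in> carrier T" "p s = f a"
  shows "((s, a), (s, a')) \<in> inn_rel (pullback T p A f)"
proof -
  interpret P: quandle "pullback T p A f" by (rule quandle_pullback[OF p f])
  interpret R: quandle "pullback T p T p" by (rule quandle_pullback[OF p p])
  have c: "t \<in> carrier T" "a \<in> carrier A" "p t = f a" using r by (auto simp: inn_rel_def pullback_carrier)
  have "((t, a), (t, a')) \<in> (step (pullback T p A f))\<^sup>*" using r by (simp add: P.inn_rel_iff)
  then obtain s' where s': "((t, s), (t, s')) \<in> (step (pullback T p T p))\<^sup>*"
    "((s, a), (s', a')) \<in> (step (pullback T p A f))\<^sup>*"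
    using pullback_path_transport[OF p f _ s(1) _ c] s(2) c(3) by fastforce
  have "((t, s), (t, s')) \<in> inn_rel (pullback T p T p)"
    using s'(1) s c by (simp add: R.inn_rel_iff pullback_carrier)
  then have "s = s'" by (rule split_byD[OF p self])
  then show ?thesis using s'(2) s c by (simp add: P.inn_rel_iff pullback_carrier)
qed

lemma mem_snd_fibre_rel:
  "(a, a') \<in> map_prod snd snd ` (Eq (pullback T p A f) fst \<inter> inn_rel (pullback T p A f)) \<longleftrightarrow>
    (\<exists>t. ((t, a), (t, a')) \<in> inn_rel (pullback T p A f))"
proof
  assume "\<exists>t. ((t, a), (t, a')) \<in> inn_rel (pullback T p A f)"
  then obtain t where t: "((t, a), (t, a')) \<in> inn_rel (pullback T p A f)" ..
  then have "((t, a), (t, a')) \<in> Eq (pullback T p A f) fst" by (auto simp: Eq_def inn_rel_def)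
  with t show "(a, a') \<in> map_prod snd snd ` (Eq (pullback T p A f) fst \<inter> inn_rel (pullback T p A f))"
    by force
qed (auto simp: Eq_def)

lemma congruence_snd_fibre_rel:
  assumes p: "extension T B p" and self: "split_by B T p T p" and f: "extension A B f"
  shows "congruence A (map_prod snd snd ` (Eq (pullback T p A f) fst \<inter> inn_rel (pullback T p A f)))"
    (is "congruence A ?S")
proof -
  interpret A: quandle A by (rule extensionD(1)[OF f])
  interpret P: quandle "pullback T p A f" by (rule quandle_pullback[OF p f])
  have mem: "(a, a') \<in> ?S \<longleftrightarrow> (\<exists>t. ((t, a), (t, a')) \<in> inn_rel (pullback T p A f))" for a a'
    by (rule mem_snd_fibre_rel)
  have car: "(t, a) \<in> carrier (pullback T p A f)" "(t, a') \<in> carrier (pullback T p A f)"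
    if "((t, a), (t, a')) \<in> inn_rel (pullback T p A f)" for t a a'
    using that by (auto simp: inn_rel_def)
  show ?thesis
  proof (rule congruenceI)
    show "equiv (carrier A) ?S"
    proof (rule equivI)
      show "?S \<subseteq> carrier A \<times> carrier A" by (auto simp: inn_rel_def pullback_carrier)
      show "refl_on (carrier A) ?S"
      proof (rule refl_onI)
        fix a assume a: "a \<in> carrier A"
        then have "f a \<in> p ` carrier T"
          using extensionD(4)[OF p] quandle_homD(1)[OF extensionD(3)[OF f]] by auto
        then obtain t where "t \<in> carrier T" "p t = f a" by auto
        then have "((t, a), (t, a)) \<in> inn_rel (pullback T p A f)"
          using a by (simp add: P.inn_rel_iff pullback_carrier)
        then show "(a, a) \<in> ?S" unfolding mem by blast
      qed
      show "sym ?S" unfolding sym_def mem using P.inn_rel_sym by blast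
      show "trans ?S"
      proof (rule transI)
        fix a b c assume "(a, b) \<in> ?S" "(b, c) \<in> ?S"
        then obtain t s where t: "((t, a), (t, b)) \<in> inn_rel (pullback T p A f)"
          and s: "((s, b), (s, c)) \<in> inn_rel (pullback T p A f)" unfolding mem by blast
        have "t \<in> carrier T" "p t = f b" using car(2)[OF t] by (auto simp: pullback_carrier)
        \<comment> \<open>The two relations are witnessed over possibly different points
          \<open>t\<close> and \<open>s\<close> above \<open>f b\<close>; the second is moved to
          \<open>t\<close> before composing.\<close>
        from self_split_inn_rel_fibre[OF p self f s this]
        show "(a, c) \<in> ?S" unfolding mem using P.inn_rel_trans[OF t] by blast
      qed
    qed
  next
    fix a a' b b' assume "(a, a') \<in> ?S" "(b, b') \<in> ?S"
    then obtain t s where t: "((t, a), (t, a')) \<in> inn_rel (pullback T p A f)"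
      and s: "((s, b), (s, b')) \<in> inn_rel (pullback T p A f)" unfolding mem by blast
    \<comment> \<open>Acting never leaves an orbit, so both products lie in the common orbit of
      \<open>(t, a)\<close> and \<open>(t, a')\<close>, and their first coordinates agree.\<close>
    note op = P.inn_rel_op[OF car(1)[OF t] car(1)[OF s]]
      and op' = P.inn_rel_op[OF car(2)[OF t] car(2)[OF s]]
    have "((t \<triangleleft>\<^bsub>T\<^esub> s, a \<triangleleft>\<^bsub>A\<^esub> b), (t \<triangleleft>\<^bsub>T\<^esub> s, a' \<triangleleft>\<^bsub>A\<^esub> b')) \<in> inn_rel (pullback T p A f)"
      using P.inn_rel_trans[OF P.inn_rel_sym[OF op(1)] P.inn_rel_trans[OF t op'(1)]]
      by (simp add: pullback_ops)
    then show "(a \<triangleleft>\<^bsub>A\<^esub> b, a' \<triangleleft>\<^bsub>A\<^esub> b') \<in> ?S" unfolding mem by blast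
    have "((t \<triangleleft>\<inverse>\<^bsub>T\<^esub> s, a \<triangleleft>\<inverse>\<^bsub>A\<^esub> b), (t \<triangleleft>\<inverse>\<^bsub>T\<^esub> s, a' \<triangleleft>\<inverse>\<^bsub>A\<^esub> b')) \<in> inn_rel (pullback T p A f)"
      using P.inn_rel_trans[OF P.inn_rel_sym[OF op(2)] P.inn_rel_trans[OF t op'(2)]]
      by (simp add: pullback_ops)
    then show "(a \<triangleleft>\<inverse>\<^bsub>A\<^esub> b, a' \<triangleleft>\<inverse>\<^bsub>A\<^esub> b') \<in> ?S" unfolding mem by blast
  qed
qed

text \<open>One inclusion is minimality of the generated congruence; it uses that the central
  extension \<open>p\<close> is split by itself. For the other, an orbit in the pullback of
  \<open>f\<close> maps into an orbit in the pullback of the reflection, which \<open>p\<close>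
  splits, so points over the same \<open>t\<close> become equal in the quotient.\<close>

lemma snd_fibre_rel_eq_covering_cong:
  assumes f: "extension A B f" and w: "weakly_universal_central_extension T B p"
  shows "map_prod snd snd ` (Eq (pullback T p A f) fst \<inter> inn_rel (pullback T p A f)) = covering_cong A f"
    (is "?S = _")
proof
  have c: "central_extension T B p" using w by (simp add: weakly_universal_central_extension_def)
  then have p: "extension T B p" by (simp add: central_extension_def)
  have "covering_rel A f \<subseteq> ?S"
    using pullback_inn_rel_covering[OF p f] unfolding covering_rel_def
    by (auto simp del: image_eqI simp: mem_snd_fibre_rel)
  then show "covering_cong A f \<subseteq> ?S" unfolding covering_cong_def
    by (rule congruence_generated_least[OF
          congruence_snd_fibre_rel[OF p weakly_universal_split_by[OF w c] f]])
  let ?Q = "quotient_quandle A (covering_cong A f)" and ?q = "quotient_map (covering_cong A f)"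
  note cov = covering_induced_map[OF f] and S = congruence_covering_cong[OF f]
  have Q: "extension ?Q B (induced_map f)" using cov by (simp add: covering_def)
  have split: "split_by B T p ?Q (induced_map f)"
    by (rule weakly_universal_split_by[OF w]) (simp add: central_extension_iff_covering cov)
  have "map_prod id ?q \<in> quandle_hom (pullback T p A f) (pullback T p ?Q (induced_map f))"
    using quandle_homD[OF quotient_map_hom[OF extensionD(1)[OF f] S]]
    by (auto simp: quandle_hom_def pullback_carrier pullback_ops induced_map_class[OF f])
  note m = hom_inn_rel[OF quandle_pullback[OF p f] quandle_pullback[OF p Q] this]
  show "?S \<subseteq> covering_cong A f"
  proof (rule subrelI)
    fix a a' assume "(a, a') \<in> ?S"
    then obtain t where t: "((t, a), (t, a')) \<in> inn_rel (pullback T p A f)"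
      unfolding mem_snd_fibre_rel by blast
    then have "?q a = ?q a'" using m[OF t] split_byD[OF Q split] by simp
    moreover have "a \<in> carrier A" "a' \<in> carrier A" using t by (auto simp: inn_rel_def pullback_carrier)
    ultimately show "(a, a') \<in> covering_cong A f" using quotient_map_eq_iff[OF S] by blast
  qed
qed

theorem mainTheorem3:
  fixes A :: "'a quandle" and B :: "'b quandle" and f :: "'a \<Rightarrow> 'b"
  assumes "extension A B f"
  shows "let Rc = covering_cong A f; Q = quotient_quandle A Rc; q\<^sub>R = quotient_map Rc; c = induced_map f in
    Rc \<subseteq> Eq A f
    \<and> q\<^sub>R \<in> quandle_hom A Q
    \<and> c \<in> quandle_hom Q B
    \<and> (\<forall>a\<in>carrier A. c (q\<^sub>R a) = f a)
    \<and> central_extension Q B c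
    \<and> (\<forall>(A' :: 'c quandle) q c'.
          q \<in> quandle_hom A A' \<and> central_extension A' B c' \<and> (\<forall>a\<in>carrier A. c' (q a) = f a) \<longrightarrow>
          (\<exists>!\<phi>. \<phi> \<in> extensional (carrier Q) \<and> \<phi> \<in> quandle_hom Q A'
             \<and> (\<forall>X\<in>carrier Q. c' (\<phi> X) = c X) \<and> (\<forall>a\<in>carrier A. \<phi> (q\<^sub>R a) = q a)))
    \<and> (\<forall>(T :: 't quandle) p. weakly_universal_central_extension T B p \<longrightarrow>
          map_prod snd snd ` (Eq (pullback T p A f) fst \<inter> inn_rel (pullback T p A f)) = Rc)"
proof -
  let ?Rc = "covering_cong A f"
  have "quotient_map ?Rc \<in> quandle_hom A (quotient_quandle A ?Rc)"
    by (rule quotient_map_hom[OF extensionD(1)[OF assms] congruence_covering_cong[OF assms]])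
  moreover have "induced_map f \<in> quandle_hom (quotient_quandle A ?Rc) B"
    using covering_induced_map[OF assms] extensionD(3) unfolding covering_def by blast
  \<comment> \<open>Rewriting centrality as the covering condition removes the splitting quandles
    from the reflection property.\<close>
  ultimately show ?thesis
    unfolding Let_def central_extension_iff_covering
    using covering_cong_subset_Eq[OF assms] covering_induced_map[OF assms] induced_map_class[OF assms]
    by (intro conjI allI impI ballI reflection_exists_unique[OF assms]
        snd_fibre_rel_eq_covering_cong[OF assms]) (assumption | elim conjE, assumption | simp)+
qed

end
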